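(* Let $G = G_2(\alpha,\beta,\epsilon,\delta,-)$ be a metacyclic $2$-group of negative type with $\delta\ge 2$. Then $\eta(G)\ge\alpha+\beta-2$. Equality holds if and only if $\beta=\delta$ and either (i) $\beta=3$, or (ii) $\beta\ge 4$ and $\alpha-\beta=2$.
   Context: For a finite group $G$, a maximal cyclic subgroup is a cyclic subgroup not properly contained in any other cyclic subgroup, and $\eta(G)$ is the number of conjugacy classes of maximal cyclic subgroups of $G$. Write $x^y = y^{-1}xy$. For integers $\alpha,\beta>0$, $\delta\ge 0$, $\epsilon\in\{0,1\}$ with $\delta\le\beta$, $\alpha-\delta\ge 2$ and $\delta+\epsilon\le\alpha$ (and $\beta\ge\delta+1$ when $\epsilon=1$), the metacyclic $2$-group of negative type is $$G_2(\alpha,\beta,\epsilon,\delta,-)=\langle x,y \mid x^{2^\alpha}=1,\ y^{2^\beta}=x^{2^{\alpha-\epsilon}},\ x^y=x^{r}\rangle,\quad r=2^{\alpha-\delta}-1.$$ It has order $2^{\alpha+\beta}$. *)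

theory Defs
  imports "HOL-Algebra.Algebra"
begin

definition cyclic_subgroup :: "'a set \<Rightarrow> ('a, 'b) monoid_scheme \<Rightarrow> bool" where
  "cyclic_subgroup H G \<longleftrightarrow> subgroup H G \<and> cyclic_group (G\<lparr>carrier := H\<rparr>)"

definition maximal_cyclic_subgroup :: "'a set \<Rightarrow> ('a, 'b) monoid_scheme \<Rightarrow> bool" where
  "maximal_cyclic_subgroup M G \<longleftrightarrow>
     cyclic_subgroup M G \<and> \<not> (\<exists>C. cyclic_subgroup C G \<and> M \<subset> C)"

definition conj_class_subgroup :: "('a, 'b) monoid_scheme \<Rightarrow> 'a set \<Rightarrow> 'a set set" where
  "conj_class_subgroup G H = (\<lambda>g. inv\<^bsub>G\<^esub> g <#\<^bsub>G\<^esub> (H #>\<^bsub>G\<^esub> g)) ` carrier G"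

definition eta :: "('a, 'b) monoid_scheme \<Rightarrow> nat" where
  "eta G = card (conj_class_subgroup G ` {M. maximal_cyclic_subgroup M G})"

text \<open>
  A word is a list of letters \<open>(s, b)\<close>; the letter \<open>(s, True)\<close> stands for the generator \<open>s\<close>
  and \<open>(s, False)\<close> for its formal inverse. The presented group consists of the words modulo
  the least congruence of the word monoid that contains the given relations and cancels adjacent
  mutually inverse letters. All elements of the type \<open>'s\<close> are generators.
\<close>

type_synonym 's word = "('s \<times> bool) list"

inductive pres_eq :: "('s word \<times> 's word) set \<Rightarrow> 's word \<Rightarrow> 's word \<Rightarrow> bool"
  for R where
  refl: "pres_eq R u u"
| sym: "pres_eq R u v \<Longrightarrow> pres_eq R v u"
| trans: "pres_eq R u v \<Longrightarrow> pres_eq R v w \<Longrightarrow> pres_eq R u w"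
| append: "pres_eq R u u' \<Longrightarrow> pres_eq R v v' \<Longrightarrow> pres_eq R (u @ v) (u' @ v')"
| cancel: "pres_eq R [(s, b), (s, \<not> b)] []"
| rel: "(u, v) \<in> R \<Longrightarrow> pres_eq R u v"

definition pres_class :: "('s word \<times> 's word) set \<Rightarrow> 's word \<Rightarrow> 's word set" where
  "pres_class R u = {v. pres_eq R u v}"

definition presented_group :: "('s word \<times> 's word) set \<Rightarrow> 's word set monoid" where
  "presented_group R =
     \<lparr>carrier = range (pres_class R),
      monoid.mult = (\<lambda>A B. \<Union>u\<in>A. \<Union>v\<in>B. pres_class R (u @ v)),
      one = pres_class R []\<rparr>"

lemma pres_class_eq_iff: "pres_class R u = pres_class R v \<longleftrightarrow> pres_eq R u v"
  unfolding pres_class_def set_eq_iff mem_Collect_eq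
  by (meson pres_eq.refl pres_eq.sym pres_eq.trans)

lemma mult_pres_class:
  "pres_class R u \<otimes>\<^bsub>presented_group R\<^esub> pres_class R v = pres_class R (u @ v)"
proof -
  have "pres_class R (u' @ v') = pres_class R (u @ v)"
    if "u' \<in> pres_class R u" "v' \<in> pres_class R v" for u' v'
    using that unfolding pres_class_eq_iff
    unfolding pres_class_def mem_Collect_eq by (rule pres_eq.append[THEN pres_eq.sym])
  then have "(\<Union>u'\<in>pres_class R u. \<Union>v'\<in>pres_class R v. pres_class R (u' @ v')) =
      (\<Union>u'\<in>pres_class R u. \<Union>v'\<in>pres_class R v. pres_class R (u @ v))"
    by (intro SUP_cong) (rule HOL.refl | blast)+
  moreover have "pres_class R u \<noteq> {}" "pres_class R v \<noteq> {}"
    using pres_eq.refl[of R] unfolding pres_class_def by blast+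
  ultimately show ?thesis
    by (simp add: presented_group_def)
qed

lemma pres_eq_left_inverse: "\<exists>v. pres_eq R (v @ u) []"
proof (induction u)
  case Nil
  show ?case by (metis append_Nil pres_eq.refl)
next
  case (Cons l u)
  obtain s b where l: "l = (s, b)" by (cases l)
  from Cons obtain v where v: "pres_eq R (v @ u) []" by blast
  have "pres_eq R [(s, \<not> b), (s, b)] []"
    using pres_eq.cancel[of R s "\<not> b"] by simp
  then have "pres_eq R (v @ [(s, \<not> b), (s, b)] @ u) (v @ [] @ u)"
    by (intro pres_eq.append pres_eq.refl)
  then have "pres_eq R ((v @ [(s, \<not> b)]) @ l # u) []"
    using pres_eq.trans[OF _ v] by (simp add: l)
  then show ?case by blast
qed

lemma group_presented_group: "group (presented_group R)"
proof (rule groupI)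
  fix x
  assume "x \<in> carrier (presented_group R)"
  then obtain u where u: "x = pres_class R u"
    by (auto simp: presented_group_def)
  obtain v where "pres_eq R (v @ u) []"
    using pres_eq_left_inverse by blast
  then have "pres_class R v \<otimes>\<^bsub>presented_group R\<^esub> x = \<one>\<^bsub>presented_group R\<^esub>"
    unfolding u mult_pres_class by (simp add: presented_group_def pres_class_eq_iff)
  moreover have "pres_class R v \<in> carrier (presented_group R)"
    by (simp add: presented_group_def)
  ultimately show "\<exists>y\<in>carrier (presented_group R).
      y \<otimes>\<^bsub>presented_group R\<^esub> x = \<one>\<^bsub>presented_group R\<^esub>"
    by blast
next
  show "\<one>\<^bsub>presented_group R\<^esub> \<in> carrier (presented_group R)"
    by (simp add: presented_group_def)
next
  fix x y
  assume "x \<in> carrier (presented_group R)" "y \<in> carrier (presented_group R)"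
  then obtain u v where "x = pres_class R u" "y = pres_class R v"
    by (auto simp: presented_group_def)
  then show "x \<otimes>\<^bsub>presented_group R\<^esub> y \<in> carrier (presented_group R)"
    by (simp only: mult_pres_class) (simp add: presented_group_def)
next
  fix x y z
  assume "x \<in> carrier (presented_group R)" "y \<in> carrier (presented_group R)"
    "z \<in> carrier (presented_group R)"
  then obtain u v w where "x = pres_class R u" "y = pres_class R v" "z = pres_class R w"
    by (auto simp: presented_group_def)
  then show "x \<otimes>\<^bsub>presented_group R\<^esub> y \<otimes>\<^bsub>presented_group R\<^esub> z =
      x \<otimes>\<^bsub>presented_group R\<^esub> (y \<otimes>\<^bsub>presented_group R\<^esub> z)"
    by (simp add: mult_pres_class)
next
  fix x
  assume "x \<in> carrier (presented_group R)"
  then obtain u where u: "x = pres_class R u"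
    by (auto simp: presented_group_def)
  have "\<one>\<^bsub>presented_group R\<^esub> = pres_class R []"
    by (simp add: presented_group_def)
  then show "\<one>\<^bsub>presented_group R\<^esub> \<otimes>\<^bsub>presented_group R\<^esub> x = x"
    by (simp add: u mult_pres_class)
qed

datatype metacyclic_gen = Gen_x | Gen_y

abbreviation gen_pow :: "'s \<Rightarrow> nat \<Rightarrow> 's word" where
  "gen_pow s n \<equiv> replicate n (s, True)"

definition metacyclic_neg_relations ::
    "nat \<Rightarrow> nat \<Rightarrow> nat \<Rightarrow> nat \<Rightarrow> (metacyclic_gen word \<times> metacyclic_gen word) set" where
  "metacyclic_neg_relations \<alpha> \<beta> \<epsilon> \<delta> =
     {(gen_pow Gen_x (2 ^ \<alpha>), []),
      (gen_pow Gen_y (2 ^ \<beta>), gen_pow Gen_x (2 ^ (\<alpha> - \<epsilon>))),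
      ([(Gen_y, False), (Gen_x, True), (Gen_y, True)], gen_pow Gen_x (2 ^ (\<alpha> - \<delta>) - 1))}"

text \<open>
  The group \<open>G\<^sub>2(\<alpha>,\<beta>,\<epsilon>,\<delta>,-)\<close>. The natural number subtractions above are exact for
  admissible parameters, i.e. \<open>\<epsilon> \<in> {0, 1}\<close>, \<open>\<alpha> \<ge> \<delta> + 2\<close>, etc.
\<close>

definition metacyclic_neg ::
    "nat \<Rightarrow> nat \<Rightarrow> nat \<Rightarrow> nat \<Rightarrow> metacyclic_gen word set monoid" where
  "metacyclic_neg \<alpha> \<beta> \<epsilon> \<delta> = presented_group (metacyclic_neg_relations \<alpha> \<beta> \<epsilon> \<delta>)"

end

theory Submission
  imports Defs "HOL-Number_Theory.Cong"
begin

text \<open>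
  Put \<open>c = \<alpha> - \<delta>\<close> and \<open>r = 2\<^sup>c - 1\<close>. Every element of the group is some \<open>y\<^sup>j x\<^sup>i\<close>, and the relation
  \<open>x y = y x\<^sup>r\<close> gives \<open>(y\<^sup>j x\<^sup>i)(y\<^sup>l x\<^sup>k) = y\<^bsup>j+l\<^esup> x\<^sup>e\<close> with \<open>e = i r\<^sup>l + k\<close>. In a nontrivial
  finite 2-group a cyclic subgroup is maximal exactly if its generators are not squares, so \<open>\<eta>\<close> is the
  number of classes of non-squares under conjugation and odd powers (\<open>maximal_cyclic_subgroup_iff\<close>,
  \<open>conj_class_subgroup_eq_iff\<close>). The square of \<open>y\<^sup>l x\<^sup>k\<close> has coordinates \<open>2l\<close> and \<open>k (r\<^sup>l + 1)\<close>. Hence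
  the non-squares are of three kinds, which no conjugation and no odd power can mix: \<open>j\<close> odd; \<open>j\<close> even
  and \<open>i\<close> odd; \<open>j\<close> an odd multiple of 2 and \<open>i\<close> even but not divisible by \<open>2\<^sup>c\<close>.

  If \<open>j\<close> is even, then \<open>r\<^sup>j\<close> is 1 modulo \<open>2\<^bsup>c+1\<^esup>\<close>. So an \<open>m\<close>-th power with \<open>m\<close> odd,
  followed by a conjugation, multiplies \<open>j\<close> by \<open>m\<close> and, modulo \<open>2\<^bsup>c+1\<^esup>\<close>, multiplies \<open>i\<close> by \<open>m r\<^sup>l\<close> for
  some \<open>l\<close> (\<open>power_conjugate_even\<close>). The following non-squares are therefore inequivalent: \<open>y\<close> and
  \<open>y x\<close> of the first kind, by the parity of \<open>i\<close>; of the second kind \<open>x\<close>,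
  the \<open>y\<^sup>j x\<close> with \<open>j = 2\<^sup>k\<close>, \<open>1 \<le> k < \<beta>\<close>, and those with
  \<open>j = 5 * 2\<^sup>k\<close>, \<open>1 \<le> k \<le> \<beta> - 3\<close>; of the third kind the \<open>y\<^sup>2 x\<^sup>i\<close> with \<open>i = 2\<^sup>k\<close>, \<open>1 \<le> k < c\<close>, and
  \<open>y\<^sup>2 x\<^sup>6\<close> if \<open>c \<ge> 3\<close> and \<open>\<beta> \<ge> 4\<close>. Indeed, in the last two kinds the
  powers of two in \<open>j\<close> and \<open>i\<close>, respectively, are
  invariants, and what is left is seen modulo 8: the powers of \<open>r\<close> are 1 and 3 there if \<open>c = 2\<close>,
  and 1 and 7 otherwise.

  These invariants depend only on \<open>j\<close> modulo \<open>2\<^sup>\<beta>\<close> and \<open>i\<close> modulo \<open>2\<^bsup>\<alpha>-\<epsilon>\<^esup>\<close>, that is, on the image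
  in the semidirect product of cyclic groups of these orders. They give
  \<open>\<eta> \<ge> 2 + (\<beta> + max 0 (\<beta> - 3)) + (c - 1)\<close>, and one more if \<open>c \<ge> 3\<close> and \<open>\<beta> \<ge> 4\<close>
  (\<open>card_reps_le_eta\<close>, \<open>card_reps\<close>). As \<open>\<alpha> + \<beta> - 2 = c + \<delta> + \<beta> - 2\<close> and \<open>\<delta> \<le> \<beta>\<close>, this is at
  least the asserted bound, and it is equal to the bound only if \<open>\<beta> = \<delta>\<close> and either \<open>\<beta> = 3\<close>, or
  \<open>\<beta> \<ge> 4\<close> and \<open>c = 2\<close>. In these cases \<open>\<epsilon> = 0\<close>, the coordinates determine the element, and
  every non-square can be moved to the list (\<open>eta_eq_card_reps\<close>). If \<open>\<beta> = 3\<close>, only residues modulo 4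
  have to be adjusted, and \<open>r\<close> is 3 modulo 4; if \<open>c = 2\<close>, then \<open>r = 3\<close>, whose powers modulo
  \<open>2\<^sup>n\<close>, \<open>n \<ge> 3\<close>, are all the residues that are 1 or 3 modulo 8.
\<close>


section \<open>Maximal cyclic subgroups of finite groups of two-power exponent\<close>

locale finite_two_group = group G for G (structure) +
  fixes K :: nat
  assumes fin: "finite (carrier G)"
    and exponent: "x \<in> carrier G \<Longrightarrow> x [^] ((2::nat) ^ K) = \<one>"
begin

lemma generate_nat: "x \<in> carrier G \<Longrightarrow> generate G {x} = {x [^] n |n. n \<in> (UNIV::nat set)}"
  using generate_pow_on_finite_carrier[OF fin] by blast

lemma nat_pow_cong:
  assumes "x \<in> carrier G" "a mod 2 ^ K = b mod (2::nat) ^ K"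
  shows "x [^] a = x [^] b"
proof -
  have *: "x [^] n = x [^] (n mod 2 ^ K)" for n :: nat
  proof -
    have "x [^] n = x [^] ((2::nat) ^ K * (n div 2 ^ K) + n mod 2 ^ K)" by simp
    also have "\<dots> = x [^] (n mod 2 ^ K)"
      unfolding nat_pow_mult[OF assms(1), symmetric] nat_pow_pow[OF assms(1), symmetric]
      using assms(1) by (simp add: exponent)
    finally show ?thesis .
  qed
  show ?thesis using *[of a] *[of b] assms(2) by simp
qed

text \<open>
  An odd exponent is invertible modulo the group exponent \<open>2\<^sup>K\<close>; hence an element and its odd powers
  generate the same subgroup.
\<close>

lemma odd_power_root:
  assumes "x \<in> carrier G" "odd (m::nat)"
  obtains n :: nat where "(x [^] m) [^] n = x"
proof -
  have "coprime m (2 ^ K)" using assms(2) by simp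
  then obtain n where "[m * n = 1] (mod 2 ^ K)" using cong_solve_coprime_nat[of m "2 ^ K"] by auto
  then have "x [^] (m * n) = x [^] (1::nat)"
    by (intro nat_pow_cong[OF assms(1)]) (simp add: cong_def)
  then have "(x [^] m) [^] n = x" using assms(1) by (simp add: nat_pow_pow)
  then show ?thesis by (rule that)
qed

lemma generate_power_subset:
  assumes "x \<in> carrier G"
  shows "generate G {x [^] (m::nat)} \<subseteq> generate G {x}"
  using assms by (auto simp: generate_nat nat_pow_pow)

lemma generate_odd_power:
  assumes "x \<in> carrier G" "odd (m::nat)"
  shows "generate G {x [^] m} = generate G {x}"
proof -
  obtain n :: nat where "(x [^] m) [^] n = x" using odd_power_root assms by blast
  then show ?thesis
    using generate_power_subset[of x m] generate_power_subset[of "x [^] m" n] assms by auto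
qed

text \<open>
  From \<open>x\<^sup>m = x\<close> with \<open>m\<close> even, \<open>x\<close> has an order dividing the odd number \<open>m - 1\<close>.
\<close>

lemma fixed_by_even_power_imp_one:
  assumes "x \<in> carrier G" "even (m::nat)" "x [^] m = x"
  shows "x = \<one>"
proof (cases "m = 0")
  case False
  then obtain n where m: "m = Suc n" by (cases m) auto
  then have "x [^] n = \<one>" using assms(1,3) by (simp add: r_cancel_one)
  moreover obtain k :: nat where "(x [^] n) [^] k = x"
    using odd_power_root[OF assms(1), of n] assms(2) m by auto
  ultimately show ?thesis by simp
qed (use assms in auto)

text \<open>
  Each of \<open>x\<close>, \<open>y\<close> is a power of the other. If \<open>y = x\<^sup>m\<close> with \<open>m\<close> even, then \<open>x\<close> equals an even
  power of itself and is trivial, so that the exponent 1 does as well.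
\<close>

lemma generate_eq_imp_odd_power:
  assumes "x \<in> carrier G" "y \<in> carrier G" "generate G {x} = generate G {y}"
  obtains m :: nat where "odd m" "y = x [^] m"
proof -
  have "y \<in> generate G {x}" "x \<in> generate G {y}"
    using assms(3) generate.incl[of y "{y}" G] generate.incl[of x "{x}" G] by auto
  then have "\<exists>m::nat. y = x [^] m" "\<exists>n::nat. x = y [^] n"
    unfolding generate_nat[OF assms(1)] generate_nat[OF assms(2)] by simp_all
  then obtain m n :: nat where m: "y = x [^] m" and n: "x = y [^] n"
    by (elim exE)
  show ?thesis
  proof (cases "odd m")
    case False
    have "x [^] (m * n) = (x [^] m) [^] n" using assms(1) by (simp add: nat_pow_pow)
    also have "\<dots> = x" by (simp only: m[symmetric] n[symmetric])
    finally have "x [^] (m * n) = x" .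
    then have "x = \<one>" using False fixed_by_even_power_imp_one[OF assms(1), of "m * n"] by simp
    then show ?thesis using m that[of 1] by simp
  qed (use m that in blast)
qed

lemma cyclic_subgroup_iff: "cyclic_subgroup H G \<longleftrightarrow> (\<exists>x\<in>carrier G. H = generate G {x})"
proof
  assume H: "cyclic_subgroup H G"
  then have sub: "subgroup H G" by (simp add: cyclic_subgroup_def)
  from H obtain x where "x \<in> H" "subgroup_generated (G\<lparr>carrier := H\<rparr>) {x} = G\<lparr>carrier := H\<rparr>"
    by (auto simp: cyclic_subgroup_def cyclic_group_def)
  then have "generate (G\<lparr>carrier := H\<rparr>) {x} = H"
    using carrier_subgroup_generated[of "G\<lparr>carrier := H\<rparr>" "{x}"] by simp
  moreover have "generate (G\<lparr>carrier := H\<rparr>) {x} = generate G {x}"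
    using generate_consistent[OF _ sub] \<open>x \<in> H\<close> by auto
  ultimately show "\<exists>x\<in>carrier G. H = generate G {x}"
    using \<open>x \<in> H\<close> subgroup.subset[OF sub] by auto
next
  assume "\<exists>x\<in>carrier G. H = generate G {x}"
  then obtain x where x: "x \<in> carrier G" "H = generate G {x}" by blast
  have "subgroup H G" using x generate_is_subgroup by simp
  moreover have "cyclic_group (G\<lparr>carrier := H\<rparr>)"
    using cyclic_group_generated[of x] x by (simp add: subgroup_generated_def)
  ultimately show "cyclic_subgroup H G" by (simp add: cyclic_subgroup_def)
qed

definition non_squares :: "'a set" where
  "non_squares = carrier G - (\<lambda>x. x \<otimes> x) ` carrier G"

text \<open>
  A cyclic subgroup that properly contains \<open>\<langle>x\<rangle>\<close> has a generator \<open>y\<close> with \<open>x = y\<^sup>k\<close>;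
  as orders are powers of two, \<open>k\<close> must be even, so \<open>x\<close> is a square. Only the trivial group
  has a trivial maximal cyclic subgroup, generated by the square \<open>\<one>\<close>.
\<close>

lemma maximal_cyclic_subgroup_iff:
  assumes "carrier G \<noteq> {\<one>}"
  shows "maximal_cyclic_subgroup M G \<longleftrightarrow> (\<exists>x\<in>non_squares. M = generate G {x})"
proof
  assume M: "maximal_cyclic_subgroup M G"
  then obtain x where x: "x \<in> carrier G" "M = generate G {x}"
    by (auto simp: maximal_cyclic_subgroup_def cyclic_subgroup_iff)
  have max: "generate G {x} = generate G {y}"
    if "y \<in> carrier G" "generate G {x} \<subseteq> generate G {y}" for y
    using that M x by (auto simp: maximal_cyclic_subgroup_def cyclic_subgroup_iff)
  have "x \<notin> (\<lambda>x. x \<otimes> x) ` carrier G"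
  proof
    assume "x \<in> (\<lambda>x. x \<otimes> x) ` carrier G"
    then obtain y where y: "y \<in> carrier G" "x = y [^] (2::nat)"
      by (auto simp: numeral_2_eq_2)
    then have "generate G {x} = generate G {y}"
      using max[of y] generate_power_subset by auto
    then obtain m :: nat where m: "y = x [^] m"
      using generate_eq_imp_odd_power[OF x(1) y(1)] by blast
    have "y [^] (2 * m) = (y [^] (2::nat)) [^] m" using y(1) by (simp add: nat_pow_pow)
    also have "\<dots> = y" by (simp only: y(2)[symmetric] m[symmetric])
    finally have "y [^] (2 * m) = y" .
    then have "y = \<one>" using fixed_by_even_power_imp_one[OF y(1), of "2 * m"] by force
    then have "x = \<one>" using y by simp
    obtain z where z: "z \<in> carrier G" "z \<noteq> \<one>" using assms by blast
    have "generate G {\<one>} \<subseteq> generate G {z}" using generate_power_subset[of z 0] z by simp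
    then have "generate G {z} = generate G {\<one>}" using max[of z] z \<open>x = \<one>\<close> by simp
    then show False using z generate_one by (metis generate.incl singletonD singletonI)
  qed
  then show "\<exists>x\<in>non_squares. M = generate G {x}" using x by (auto simp: non_squares_def)
next
  assume "\<exists>x\<in>non_squares. M = generate G {x}"
  then obtain x where x: "x \<in> carrier G" "x \<notin> (\<lambda>x. x \<otimes> x) ` carrier G" "M = generate G {x}"
    by (auto simp: non_squares_def)
  have "\<not> generate G {x} \<subset> generate G {y}" if y: "y \<in> carrier G" for y
  proof
    assume less: "generate G {x} \<subset> generate G {y}"
    then have "x \<in> generate G {y}" using generate.incl[of x "{x}"] by auto
    then obtain m :: nat where m: "x = y [^] m" using y by (auto simp: generate_nat)
    show False
    proof (cases "even m")
      case True
      then obtain k where "m = k + k" by (metis evenE mult_2)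
      then have "x = y [^] k \<otimes> y [^] k" using m y by (simp add: nat_pow_mult)
      then show False using x(2) y by auto
    qed (use less m generate_odd_power[OF y] in auto)
  qed
  then show "maximal_cyclic_subgroup M G"
    using x by (auto simp: maximal_cyclic_subgroup_def cyclic_subgroup_iff)
qed

text \<open>
  The relation that conjugacy of cyclic subgroups induces on their generators. The conjugation is
  written as \<open>g y = x\<^sup>m g\<close>, without inverses, because products are easy to compute in coordinates
  and inverses are not.
\<close>

definition power_conjugate :: "'a \<Rightarrow> 'a \<Rightarrow> bool" where
  "power_conjugate x y \<longleftrightarrow> (\<exists>g\<in>carrier G. \<exists>m::nat. odd m \<and> g \<otimes> y = x [^] m \<otimes> g)"

lemma conjugate_nat_pow:
  assumes "x \<in> carrier G" "g \<in> carrier G"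
  shows "(inv g \<otimes> (x \<otimes> g)) [^] (n::nat) = inv g \<otimes> (x [^] n \<otimes> g)"
proof (induction n)
  case (Suc n)
  have "g \<otimes> (inv g \<otimes> (x \<otimes> g)) = x \<otimes> g"
    using assms by (metis inv_closed m_assoc m_closed r_inv l_one)
  then show ?case using Suc assms by (simp add: m_assoc)
qed (use assms in simp)

lemma conjugate_generate:
  assumes "x \<in> carrier G" "g \<in> carrier G"
  shows "inv g <# (generate G {x} #> g) = generate G {inv g \<otimes> (x \<otimes> g)}"
  using assms by (auto simp: generate_nat l_coset_def r_coset_def conjugate_nat_pow)

lemma conj_class_subgroup_generate:
  assumes "x \<in> carrier G"
  shows "conj_class_subgroup G (generate G {x})
    = (\<lambda>g. generate G {inv g \<otimes> (x \<otimes> g)}) ` carrier G"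
  using assms by (simp add: conj_class_subgroup_def conjugate_generate)

text \<open>
  The conjugates of \<open>\<langle>x\<rangle>\<close> are the subgroups generated by the conjugates of \<open>x\<close>, and an element generates
  the same subgroup as a conjugate \<open>z\<close> of \<open>x\<close> if and only if it is an odd power of \<open>z\<close>.
\<close>

lemma conj_class_subgroup_eq_iff:
  assumes x: "x \<in> carrier G" and y: "y \<in> carrier G"
  shows "conj_class_subgroup G (generate G {x}) = conj_class_subgroup G (generate G {y})
    \<longleftrightarrow> power_conjugate x y"
proof
  assume eq: "conj_class_subgroup G (generate G {x}) = conj_class_subgroup G (generate G {y})"
  have "generate G {inv \<one> \<otimes> (y \<otimes> \<one>)} \<in> conj_class_subgroup G (generate G {y})"
    unfolding conj_class_subgroup_generate[OF y] by blast
  then obtain g where g: "g \<in> carrier G" "generate G {y} = generate G {inv g \<otimes> (x \<otimes> g)}"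
    using y unfolding eq[symmetric] conj_class_subgroup_generate[OF x] by auto
  then obtain m :: nat where m: "odd m" "y = (inv g \<otimes> (x \<otimes> g)) [^] m"
    using x y generate_eq_imp_odd_power[of "inv g \<otimes> (x \<otimes> g)" y] by auto
  then have "g \<otimes> y = x [^] m \<otimes> g"
    using x g by (simp add: conjugate_nat_pow) (metis inv_closed l_one m_assoc m_closed nat_pow_closed r_inv)
  then show "power_conjugate x y" using g m by (auto simp: power_conjugate_def)
next
  assume "power_conjugate x y"
  then obtain g and m :: nat where g: "g \<in> carrier G" "odd m" "g \<otimes> y = x [^] m \<otimes> g"
    by (auto simp: power_conjugate_def)
  let ?z = "inv g \<otimes> (x \<otimes> g)"
  have "y = inv g \<otimes> (x [^] m \<otimes> g)"
    unfolding g(3)[symmetric] using g(1) y by (metis inv_closed l_inv l_one m_assoc)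
  then have "y = ?z [^] m" using x g by (simp add: conjugate_nat_pow)
  then have y_z: "generate G {y} = generate G {?z}"
    using generate_odd_power[of ?z m] g x by simp
  have z: "inv h \<otimes> (?z \<otimes> h) = inv (g \<otimes> h) \<otimes> (x \<otimes> (g \<otimes> h))" if "h \<in> carrier G" for h
    using that x g by (simp add: inv_mult_group m_assoc)
  have "(\<lambda>h. generate G {inv h \<otimes> (?z \<otimes> h)}) ` carrier G
      = (\<lambda>h. generate G {inv h \<otimes> (x \<otimes> h)}) ` (\<lambda>h. g \<otimes> h) ` carrier G"
    unfolding image_image using z by (intro image_cong) auto
  also have "(\<lambda>h. g \<otimes> h) ` carrier G = carrier G"
    using g(1) surj_const_mult by blast
  finally show "conj_class_subgroup G (generate G {x}) = conj_class_subgroup G (generate G {y})"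
    unfolding y_z using x g by (simp add: conj_class_subgroup_generate)
qed

lemma power_conjugate_trans:
  assumes "x \<in> carrier G" "y \<in> carrier G" "z \<in> carrier G"
    and "power_conjugate x y" "power_conjugate y z"
  shows "power_conjugate x z"
  using assms by (simp flip: conj_class_subgroup_eq_iff)

text \<open>
  If \<open>y\<close> is a square, so is its conjugate \<open>x\<^sup>m\<close>, and \<open>x\<close> is a power of \<open>x\<^sup>m\<close>.
\<close>

lemma non_squares_power_conjugate:
  assumes "x \<in> non_squares" "y \<in> carrier G" "power_conjugate x y"
  shows "y \<in> non_squares"
proof -
  have x: "x \<in> carrier G" using assms(1) by (simp add: non_squares_def)
  obtain g and m :: nat where g: "g \<in> carrier G" "odd m" "g \<otimes> y = x [^] m \<otimes> g"
    using assms(3) by (auto simp: power_conjugate_def)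
  obtain n :: nat where n: "(x [^] m) [^] n = x" using odd_power_root x g(2) by blast
  have False if h: "h \<in> carrier G" "y = h \<otimes> h" for h
  proof -
    let ?z = "g \<otimes> h \<otimes> inv g"
    have "x [^] m = g \<otimes> y \<otimes> inv g" unfolding g(3) using x g(1) by (simp add: m_assoc)
    also have "\<dots> = ?z \<otimes> ?z"
    proof -
      have "inv g \<otimes> (g \<otimes> (h \<otimes> inv g)) = h \<otimes> inv g"
        using g(1) h(1) by (metis inv_closed l_inv l_one m_assoc m_closed)
      then show ?thesis unfolding h(2) using g(1) h(1) by (simp add: m_assoc)
    qed
    also have "\<dots> = ?z [^] (2::nat)" using g(1) h(1) by (simp add: numeral_2_eq_2)
    finally have "(x [^] m) [^] n = ?z [^] (n + n)"
      using g(1) h(1) by (simp add: nat_pow_pow mult_2)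
    then have "x = ?z [^] n \<otimes> ?z [^] n" using n g(1) h(1) by (simp add: nat_pow_mult)
    then show False using assms(1) g(1) h(1) by (auto simp: non_squares_def)
  qed
  then show ?thesis using assms(2) by (auto simp: non_squares_def)
qed

lemma eta_eq_card_image:
  assumes "carrier G \<noteq> {\<one>}"
  shows "eta G = card ((\<lambda>x. conj_class_subgroup G (generate G {x})) ` non_squares)"
proof -
  have "{M. maximal_cyclic_subgroup M G} = (\<lambda>x. generate G {x}) ` non_squares"
    using maximal_cyclic_subgroup_iff[OF assms] by auto
  then show ?thesis by (simp add: eta_def image_image)
qed

lemma eta_lower_bound:
  assumes "carrier G \<noteq> {\<one>}" "R \<subseteq> non_squares"
    and "\<And>x y. x \<in> R \<Longrightarrow> y \<in> R \<Longrightarrow> power_conjugate x y \<Longrightarrow> x = y"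
  shows "card R \<le> eta G"
proof -
  have sub: "R \<subseteq> carrier G" using assms(2) by (auto simp: non_squares_def)
  then have "inj_on (\<lambda>x. conj_class_subgroup G (generate G {x})) R"
    using assms(3) by (intro inj_onI) (simp add: conj_class_subgroup_eq_iff subset_iff)
  moreover have "finite non_squares" using fin by (simp add: non_squares_def)
  ultimately show ?thesis
    unfolding eta_eq_card_image[OF assms(1)]
    using assms(2) by (metis card_image card_mono finite_imageI image_mono)
qed

lemma eta_upper_bound:
  assumes "carrier G \<noteq> {\<one>}" "R \<subseteq> carrier G"
    and "\<And>x. x \<in> non_squares \<Longrightarrow> \<exists>y\<in>R. power_conjugate x y"
  shows "eta G \<le> card R"
proof -
  have "finite R" using assms(2) fin finite_subset by blast
  moreover have "(\<lambda>x. conj_class_subgroup G (generate G {x})) ` non_squares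
      \<subseteq> (\<lambda>x. conj_class_subgroup G (generate G {x})) ` R"
  proof (rule image_subsetI)
    fix x assume x: "x \<in> non_squares"
    then obtain y where y: "y \<in> R" "power_conjugate x y" using assms(3) by blast
    have "x \<in> carrier G" "y \<in> carrier G" using x y assms(2) by (auto simp: non_squares_def)
    then have "conj_class_subgroup G (generate G {x}) = conj_class_subgroup G (generate G {y})"
      using y(2) by (simp add: conj_class_subgroup_eq_iff)
    then show "conj_class_subgroup G (generate G {x})
        \<in> (\<lambda>x. conj_class_subgroup G (generate G {x})) ` R"
      using y(1) by blast
  qed
  ultimately show ?thesis
    unfolding eta_eq_card_image[OF assms(1)]
    by (meson card_image_le card_mono finite_imageI le_trans)
qed

end

section \<open>Congruences modulo powers of two\<close>

text \<open>
  The exponent of \<open>x\<close> in the \<open>n\<close>-th power of \<open>y\<^sup>j x\<close>, for \<open>q = r\<^sup>j\<close>.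
\<close>

definition geom_sum :: "int \<Rightarrow> nat \<Rightarrow> int" where
  "geom_sum q n = (\<Sum>s<n. q ^ s)"

lemma geom_sum_0 [simp]: "geom_sum q 0 = 0"
  and geom_sum_Suc: "geom_sum q (Suc n) = geom_sum q n + q ^ n"
  by (simp_all add: geom_sum_def)

lemma geom_sum_add: "geom_sum q (m + n) = geom_sum q m + q ^ m * geom_sum q n"
  by (induction n) (simp_all add: geom_sum_Suc power_add algebra_simps)

lemma geom_sum_Suc_left: "geom_sum q (Suc n) = 1 + q * geom_sum q n"
  using geom_sum_add[of q 1 n] by (simp add: geom_sum_def)

lemma geom_sum_cong:
  assumes "[q = 1] (mod d)"
  shows "[geom_sum q n = int n] (mod d)"
proof (induction n)
  case (Suc n)
  have "[q ^ n = 1] (mod d)" using cong_pow[OF assms, of n] by simp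
  from cong_add[OF Suc this] show ?case by (simp add: geom_sum_Suc add.commute)
qed simp

lemma cong_pow2_le:
  assumes "[a = b] (mod (2::int) ^ n)" "m \<le> n"
  shows "[a = b] (mod 2 ^ m)"
  using assms by (meson cong_dvd_modulus le_imp_power_dvd)

lemma odd_cong:
  assumes "[a = b] (mod (2::int) ^ n)" "n > 0"
  shows "odd a \<longleftrightarrow> odd b"
  using cong_pow2_le[OF assms(1), of 1] assms(2) by (simp add: cong_def even_iff_mod_2_eq_zero)

lemma odd_cong_nat:
  assumes "[a = b] (mod (2::nat) ^ n)" "n > 0"
  shows "odd a \<longleftrightarrow> odd b"
  using assms odd_cong[of "int a" "int b" n] by (simp flip: cong_int_iff)

lemma solve_linear_pow2:
  assumes "odd (u::int)"
  obtains k where "[u * k = t] (mod 2 ^ n)"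
proof -
  have "coprime u (2 ^ n)" using assms by simp
  then obtain v where "[u * v = 1] (mod 2 ^ n)" using cong_solve_coprime_int by blast
  then have "[u * v * t = 1 * t] (mod 2 ^ n)" by (rule cong_scalar_right)
  then show ?thesis using that[of "v * t"] by (simp add: mult.assoc)
qed

lemma solve_linear_pow2_nat:
  assumes "odd u"
  obtains k :: nat where "[u * k = t] (mod 2 ^ n)"
proof -
  obtain k where k: "[int u * k = int t] (mod 2 ^ n)"
    using assms solve_linear_pow2[of "int u"] by auto
  have "[int u * (k mod 2 ^ n) = int t] (mod 2 ^ n)"
    using k by (simp add: cong_def mod_mult_right_eq)
  then have "[u * nat (k mod 2 ^ n) = t] (mod 2 ^ n)"
    by (simp flip: cong_int_iff)
  then show ?thesis by (rule that)
qed

text \<open>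
  The lifting step for solving congruences modulo powers of two: a solution modulo \<open>2\<^sup>n\<close> either
  works modulo \<open>2\<^bsup>n+1\<^esup>\<close>, or is corrected by any odd multiple of \<open>2\<^sup>n\<close>.
\<close>

lemma pow2_cong_split:
  assumes "[a = b] (mod (2::int) ^ n)"
  shows "[a = b] (mod 2 ^ Suc n) \<or> (\<forall>u. odd u \<longrightarrow> [a + 2 ^ n * u = b] (mod 2 ^ Suc n))"
proof -
  obtain k where k: "a - b = 2 ^ n * k" using assms by (auto simp: cong_iff_dvd_diff dvd_def)
  show ?thesis
  proof (cases "even k")
    case True
    then show ?thesis using k by (auto simp: cong_iff_dvd_diff mult.commute elim!: evenE)
  next
    case False
    have "[a + 2 ^ n * u = b] (mod 2 ^ Suc n)" if "odd u" for u
    proof -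
      have "even (k + u)" using False that by simp
      moreover have "a + 2 ^ n * u - b = 2 ^ n * (k + u)" using k by (simp add: algebra_simps)
      ultimately show ?thesis by (simp add: cong_iff_dvd_diff mult.commute mult_dvd_mono)
    qed
    then show ?thesis by blast
  qed
qed

text \<open>
  Doubling the number of terms multiplies the sum by \<open>1 + q\<^sup>k\<close>, which is 2 modulo 4.
\<close>

lemma geom_sum_pow2:
  assumes "[q = 1] (mod 4)"
  shows "\<exists>u. odd u \<and> geom_sum q (2 ^ n) = 2 ^ n * u"
proof (induction n)
  case (Suc n)
  then obtain u where u: "odd u" "geom_sum q (2 ^ n) = 2 ^ n * u" by blast
  have "[q ^ 2 ^ n = 1] (mod 4)" using cong_pow[OF assms, of "2 ^ n"] by simp
  then obtain k where "q ^ 2 ^ n - 1 = 4 * k" by (auto simp: cong_iff_dvd_diff dvd_def)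
  then have k: "q ^ 2 ^ n = 1 + 4 * k" by simp
  have "geom_sum q (2 ^ Suc n) = (1 + q ^ 2 ^ n) * geom_sum q (2 ^ n)"
    using geom_sum_add[of q "2 ^ n" "2 ^ n"] by (simp add: mult_2 algebra_simps)
  also have "\<dots> = 2 ^ Suc n * ((1 + 2 * k) * u)" unfolding k u(2) by (simp add: algebra_simps)
  finally have "geom_sum q (2 ^ Suc n) = 2 ^ Suc n * ((1 + 2 * k) * u)" .
  moreover have "odd ((1 + 2 * k) * u)" using u(1) by simp
  ultimately show ?case by blast
qed (simp add: geom_sum_def)

text \<open>
  The sums run through all residues modulo \<open>2\<^sup>n\<close>: adding \<open>2\<^sup>n\<close> terms changes the sum by an odd multiple
  of \<open>2\<^sup>n\<close>, which is what the lifting step needs.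
\<close>

lemma solve_geom_sum:
  assumes q: "[q = 1] (mod 4)" and i: "odd i"
  shows "\<exists>m. [i * geom_sum q m = t] (mod 2 ^ n)"
proof (induction n)
  case (Suc n)
  then obtain m where m: "[i * geom_sum q m = t] (mod 2 ^ n)" by blast
  obtain u where u: "odd u" "geom_sum q (2 ^ n) = 2 ^ n * u" using geom_sum_pow2[OF q] by blast
  have "odd q"
    using odd_cong[of q 1 2] q by simp
  then have "odd (i * q ^ m * u)" using u i by simp
  moreover have "i * geom_sum q (m + 2 ^ n) = i * geom_sum q m + 2 ^ n * (i * q ^ m * u)"
    by (simp add: geom_sum_add u(2) algebra_simps)
  ultimately show ?case using pow2_cong_split[OF m] by metis
qed (simp add: cong_def)

lemma pow_three_pow2: "\<exists>u::int. odd u \<and> 3 ^ 2 ^ Suc n = 1 + 2 ^ (n + 3) * u"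
proof (induction n)
  case (Suc n)
  then obtain u :: int where u: "odd u" "3 ^ 2 ^ Suc n = 1 + 2 ^ (n + 3) * u" by blast
  have "(3::int) ^ 2 ^ Suc (Suc n) = (3 ^ 2 ^ Suc n)\<^sup>2"
    by (simp flip: power_mult add: mult.commute)
  also have "\<dots> = 1 + 2 ^ (Suc n + 3) * (u + 2 ^ (n + 2) * u\<^sup>2)"
    unfolding u(2) by (simp add: power2_eq_square power_add algebra_simps)
  finally show ?case using u(1) by (intro exI[of _ "u + 2 ^ (n + 2) * u\<^sup>2"]) simp
qed (auto intro!: exI[of _ 1])

text \<open>
  For \<open>n \<ge> 3\<close> the powers of 3 modulo \<open>2\<^sup>n\<close> are all the residues that are 1 or 3 modulo 8; a solution is lifted by
  multiplying with \<open>3\<^sup>k\<close>, \<open>k\<close> a power of two, as in the preceding lemma.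
\<close>

lemma solve_pow_three:
  assumes "[a = 1] (mod 8) \<or> [a = 3] (mod (8::int))"
  shows "\<exists>l. [a * 3 ^ l = 1] (mod 2 ^ n)"
proof -
  have "\<exists>l. [a * 3 ^ l = 1] (mod 2 ^ (n + 3))"
  proof (induction n)
    case 0
    show ?case
    proof (cases "[a = 1] (mod 8)")
      case False
      then have "[a * 3 = 3 * 3] (mod 8)" using assms cong_scalar_right by blast
      then show ?thesis by (intro exI[of _ 1]) (simp add: cong_def)
    qed (auto intro!: exI[of _ 0])
  next
    case (Suc n)
    then obtain l where l: "[a * 3 ^ l = 1] (mod 2 ^ (n + 3))" by blast
    obtain u :: int where u: "odd u" "3 ^ 2 ^ Suc n = 1 + 2 ^ (n + 3) * u"
      using pow_three_pow2 by blast
    have "odd (a * 3 ^ l)" using odd_cong[OF l] by simp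
    then have "odd (a * 3 ^ l * u)" using u(1) by simp
    moreover have "a * 3 ^ (l + 2 ^ Suc n) = a * 3 ^ l + 2 ^ (n + 3) * (a * 3 ^ l * u)"
      unfolding power_add u(2) by (simp add: algebra_simps)
    ultimately show ?case using pow2_cong_split[OF l] by (metis add_Suc)
  qed
  then obtain l where "[a * 3 ^ l = 1] (mod 2 ^ (n + 3))" by blast
  then show ?thesis using cong_pow2_le le_add1 by blast
qed

lemma twist_square: "((2::int) ^ c - 1)\<^sup>2 = 1 + 2 ^ (c + 1) * (2 ^ (c - 1) - 1)" if "c > 0"
  using that by (cases c) (simp_all add: power2_eq_square algebra_simps)

lemma twist_even_power:
  assumes "c > 0" "even j"
  shows "[((2::int) ^ c - 1) ^ j = 1] (mod 2 ^ (c + 1))"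
proof -
  have "[((2::int) ^ c - 1)\<^sup>2 = 1] (mod 2 ^ (c + 1))"
    by (simp add: twist_square[OF assms(1)] cong_iff_dvd_diff)
  from cong_pow[OF this, of "j div 2"] show ?thesis
    using assms(2) by (simp flip: power_mult)
qed

lemma twist_odd_power:
  assumes "c > 0" "odd j"
  shows "[((2::int) ^ c - 1) ^ j = - 1] (mod 2 ^ c)"
proof -
  have "[(2::int) ^ c - 1 = - 1] (mod 2 ^ c)" by (simp add: cong_iff_dvd_diff)
  from cong_pow[OF this, of j] show ?thesis using assms(2) by simp
qed

text \<open>
  Squaring \<open>1 + 2\<^sup>k u\<close> with \<open>k > 0\<close> gains a factor 2 in the difference from 1, and the first squaring
  of \<open>2\<^sup>c - 1\<close> already leads to 1 modulo \<open>2\<^bsup>c+1\<^esup>\<close>.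
\<close>

lemma twist_order:
  assumes "c > 0" "n > 0"
  shows "[((2::int) ^ c - 1) ^ 2 ^ n = 1] (mod 2 ^ (c + n))"
  using assms(2)
proof (induction n rule: nat_induct_non_zero)
  case 1
  then show ?case using twist_even_power[OF assms(1), of 2] by simp
next
  case (Suc n)
  then obtain k where "((2::int) ^ c - 1) ^ 2 ^ n - 1 = 2 ^ (c + n) * k"
    by (auto simp: cong_iff_dvd_diff dvd_def)
  then have k: "((2::int) ^ c - 1) ^ 2 ^ n = 1 + 2 ^ (c + n) * k" by simp
  have "((2::int) ^ c - 1) ^ 2 ^ Suc n = (((2::int) ^ c - 1) ^ 2 ^ n)\<^sup>2"
    by (simp flip: power_mult add: mult.commute)
  also have "\<dots> = 1 + 2 ^ (c + Suc n) * (k + 2 ^ (c + n - 1) * k\<^sup>2)"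
  proof -
    have "(2::int) ^ (c + n) = 2 * 2 ^ (c + n - 1)"
      using assms(1) by (simp flip: power_Suc)
    then show ?thesis unfolding k by (simp add: power2_eq_square power_add algebra_simps)
  qed
  finally show ?case by (simp add: cong_iff_dvd_diff)
qed

lemma odd_mod_4: "odd (u::int) \<Longrightarrow> [u = 1] (mod 4) \<or> [u = 3] (mod 4)"
  by (simp add: cong_def) presburger

lemma odd_square_mod_4:
  assumes "odd (u::int)"
  shows "[u * u = 1] (mod 4)"
proof -
  obtain k where "u = 2 * k + 1" using assms by (rule oddE)
  then have "u * u - 1 = 4 * (k * k + k)" by (simp add: algebra_simps)
  then show ?thesis by (simp add: cong_iff_dvd_diff)
qed

text \<open>
  The residues 1 and 3 form a subgroup of index 2 in the units modulo 8, and 5 represents its other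
  coset.
\<close>

lemma odd_mod_8:
  assumes "odd (u::int)"
  shows "[u = 1] (mod 8) \<or> [u = 3] (mod 8) \<or> [5 * u = 1] (mod 8) \<or> [5 * u = 3] (mod 8)"
proof -
  have "u mod 8 = 1 \<or> u mod 8 = 3 \<or> u mod 8 = 5 \<or> u mod 8 = 7" using assms by presburger
  moreover have "5 * u mod 8 = 5 * (u mod 8) mod 8" by (simp add: mod_mult_right_eq)
  ultimately show ?thesis unfolding cong_def by auto
qed

lemma pow_exponent_cong:
  assumes "[q ^ d = 1] (mod (N::int))" "[l = l'] (mod d)"
  shows "[q ^ l = q ^ l'] (mod N)"
proof -
  have "[q ^ k = q ^ (k mod d)] (mod N)" for k
  proof -
    have "[(q ^ d) ^ (k div d) * q ^ (k mod d) = 1 ^ (k div d) * q ^ (k mod d)] (mod N)"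
      using assms(1) by (intro cong_mult cong_pow cong_refl)
    then show ?thesis by (simp flip: power_mult power_add)
  qed
  then show ?thesis using assms(2) cong_sym cong_trans unfolding cong_def by metis
qed

lemma pow2_odd_unique:
  assumes "2 ^ k * u = 2 ^ l * (v::int)" "odd u" "odd v"
  shows "k = l" 
proof -
  have *: False if "2 ^ k * u = 2 ^ l * (v::int)" "odd u" "k < l" for k l :: nat and u v
  proof -
    obtain d where "l = k + Suc d" using less_imp_Suc_add[OF \<open>k < l\<close>] by auto
    then have "u = 2 * 2 ^ d * v" using that(1) by (simp add: power_add)
    then show False using that(2) by simp
  qed
  show ?thesis using *[OF assms(1,2)] *[OF assms(1)[symmetric] assms(3)] by (meson linorder_neqE_nat)
qed

lemma pow2_neq_6 [simp]: "(2::int) ^ k \<noteq> 6" "6 \<noteq> (2::int) ^ k"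
  using pow2_odd_unique[of 1 3 k 1] by auto

text \<open>
  The invariants that separate the representatives are of this form: the exact power of two in a
  number, and then its odd part to the precision that remains.
\<close>

lemma pow2_odd_cong:
  assumes cong: "[2 ^ k * u = 2 ^ l * v] (mod (2::int) ^ n)" and odd: "odd u" "odd v" and "k < n"
  shows "k = l" "[u = v] (mod 2 ^ (n - k))"
proof -
  obtain d where d: "2 ^ k * u - 2 ^ l * v = 2 ^ n * d"
    using cong by (auto simp: cong_iff_dvd_diff dvd_def)
  obtain e where e: "n = k + Suc e" using less_imp_Suc_add[OF \<open>k < n\<close>] by auto
  have "2 ^ l * v = 2 ^ k * (u - 2 ^ Suc e * d)" using d unfolding e power_add by (simp add: algebra_simps)
  moreover have "odd (u - 2 ^ Suc e * d)" using odd by simp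
  ultimately show "k = l" using pow2_odd_unique odd by metis
  have "2 ^ k * (u - v) = 2 ^ k * (2 ^ (n - k) * d)"
    using d \<open>k = l\<close> e by (simp add: power_add algebra_simps)
  then have "u - v = 2 ^ (n - k) * d" by simp
  then show "[u = v] (mod 2 ^ (n - k))" by (simp add: cong_iff_dvd_diff)
qed

section \<open>Groups with twisted coordinates\<close>

text \<open>
  Here \<open>E j i\<close> stands for \<open>y\<^sup>j x\<^sup>i\<close>. The coordinate \<open>j\<close> is a natural number, so that \<open>r\<^sup>j\<close> is an integer
  although \<open>r\<close> has no inverse in the integers; \<open>i\<close> may be negative, which makes conjugations linear.
\<close>

locale twisted_product = group G for G (structure) +
  fixes E :: "nat \<Rightarrow> int \<Rightarrow> 'a" and r :: int and a b :: nat
  assumes E_closed [simp]: "E j i \<in> carrier G"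
    and E_surj: "g \<in> carrier G \<Longrightarrow> \<exists>j i. g = E j i"
    and E_mult: "E j i \<otimes> E l k = E (j + l) (i * r ^ l + k)"
    and E_cong: "[j = j'] (mod 2 ^ b) \<Longrightarrow> [i = i'] (mod 2 ^ a) \<Longrightarrow> E j i = E j' i'"
begin

lemma E_0_0: "E 0 0 = \<one>"
  using E_mult[of 0 0 0 0] E_closed[of 0 0] by (simp add: r_cancel_one)

lemma E_pow: "E j i [^] (m::nat) = E (j * m) (i * geom_sum (r ^ j) m)"
proof (induction m)
  case (Suc m)
  then show ?case
    by (simp add: E_mult geom_sum_Suc_left algebra_simps)
qed (simp add: E_0_0)

lemma finite_carrier: "finite (carrier G)"
proof (rule finite_subset)
  show "carrier G \<subseteq> (\<lambda>(j, i). E j i) ` ({..<2 ^ b} \<times> {0..<2 ^ a})"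
  proof
    fix g assume "g \<in> carrier G"
    then obtain j i where "g = E j i" using E_surj by blast
    also have "\<dots> = E (j mod 2 ^ b) (i mod 2 ^ a)" by (intro E_cong) simp_all
    finally show "g \<in> (\<lambda>(j, i). E j i) ` ({..<2 ^ b} \<times> {0..<2 ^ a})" by force
  qed
qed simp

lemma pow_exponent:
  assumes "g \<in> carrier G"
  shows "g [^] ((2::nat) ^ (a + b)) = \<one>"
proof -
  obtain j i where g: "g = E j i" using E_surj[OF assms] by blast
  have "g [^] ((2::nat) ^ (a + b)) = (g [^] ((2::nat) ^ b)) [^] ((2::nat) ^ a)"
    using assms by (simp add: nat_pow_pow power_add mult.commute)
  also have "g [^] ((2::nat) ^ b) = E 0 (i * geom_sum (r ^ j) (2 ^ b))"
    unfolding g E_pow by (intro E_cong) (simp_all add: cong_0_iff)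
  also have "\<dots> [^] ((2::nat) ^ a) = E 0 0"
    unfolding E_pow by (intro E_cong) (simp_all add: geom_sum_def cong_0_iff)
  finally show ?thesis by (simp add: E_0_0)
qed

sublocale finite_two_group G "a + b"
  by unfold_locales (simp_all add: finite_carrier pow_exponent)

end

text \<open>
  Conversely, an element determines its coordinates modulo \<open>2\<^sup>\<beta>\<close> and \<open>2\<^sup>n\<close>. These moduli may be
  smaller than the periods \<open>2\<^sup>b\<close> and \<open>2\<^sup>a\<close>: in the metacyclic group with \<open>\<epsilon> = 1\<close> the element \<open>y\<close> to the
  power \<open>2\<^sup>\<beta>\<close> is a nontrivial power of \<open>x\<close>.
\<close>

locale twisted_coordinates = twisted_product +
  fixes c \<beta> n :: nat
  assumes r_eq: "r = 2 ^ c - 1" and c: "2 \<le> c" and \<beta>: "2 \<le> \<beta>" and c_less_n: "c < n"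
    and E_eqD: "E j i = E j' i' \<Longrightarrow> [j = j'] (mod 2 ^ \<beta>) \<and> [i = i'] (mod 2 ^ n)"
begin

lemma odd_r: "odd r"
  using c by (simp add: r_eq)

lemma r_even_power: "even j \<Longrightarrow> [r ^ j = 1] (mod 2 ^ (c + 1))"
  using twist_even_power[of c j] c by (simp add: r_eq)

lemma nontrivial: "carrier G \<noteq> {\<one>}"
proof
  assume "carrier G = {\<one>}"
  then have "E 1 0 = E 0 0" by (metis E_closed singletonD)
  from E_eqD[OF this] have "[1 = (0::nat)] (mod 2 ^ \<beta>)" by simp
  then show False using \<beta> by (simp add: cong_def)
qed

text \<open>
  These are the two coordinates of the equation that defines \<open>power_conjugate\<close>, for the conjugating
  element \<open>E l k\<close>.
\<close>

lemma power_conjugateD: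
  assumes "power_conjugate (E j i) (E j' i')"
  obtains m l :: nat and k :: int where "odd m" "[j' = j * m] (mod 2 ^ \<beta>)"
    "[k * r ^ j' + i' = i * geom_sum (r ^ j) m * r ^ l + k] (mod 2 ^ n)"
proof -
  obtain g and m :: nat where g: "g \<in> carrier G" "odd m" "g \<otimes> E j' i' = E j i [^] m \<otimes> g"
    using assms by (auto simp: power_conjugate_def)
  obtain l k where "g = E l k" using E_surj[OF g(1)] by blast
  then have "E (l + j') (k * r ^ j' + i') = E (j * m + l) (i * geom_sum (r ^ j) m * r ^ l + k)"
    using g(3) by (simp add: E_pow E_mult)
  from E_eqD[OF this] have "[l + j' = l + j * m] (mod 2 ^ \<beta>)"
    and k: "[k * r ^ j' + i' = i * geom_sum (r ^ j) m * r ^ l + k] (mod 2 ^ n)"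
    by (simp_all add: add.commute)
  then show ?thesis using g(2) that by (metis cong_add_lcancel_nat)
qed

lemma power_conjugate_parity:
  assumes "power_conjugate (E j i) (E j' i')"
  shows "odd j \<longleftrightarrow> odd j'" "odd i \<longleftrightarrow> odd i'"
proof -
  obtain m l :: nat and k :: int where m: "odd m" "[j' = j * m] (mod 2 ^ \<beta>)"
    and k: "[k * r ^ j' + i' = i * geom_sum (r ^ j) m * r ^ l + k] (mod 2 ^ n)"
    using power_conjugateD[OF assms] by metis
  show "odd j \<longleftrightarrow> odd j'" using odd_cong_nat[OF m(2)] \<beta> m(1) by simp
  have "odd (r ^ j)" using odd_r by simp
  then have "[r ^ j = 1] (mod 2)" by (simp only: cong_def odd_iff_mod_2_eq_one) simp
  from geom_sum_cong[OF this, of m] have "odd (geom_sum (r ^ j) m)"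
    using odd_cong[of "geom_sum (r ^ j) m" "int m" 1] m(1) by simp
  then show "odd i \<longleftrightarrow> odd i'" using odd_cong[OF k] c_less_n odd_r by auto
qed

text \<open>
  For even \<open>j\<close> and \<open>j'\<close>, both \<open>r\<^sup>j\<close> and \<open>r\<close> to the power \<open>j'\<close> are 1 modulo \<open>2\<^bsup>c+1\<^esup>\<close>. Thus the term
  with \<open>k\<close> cancels and the geometric sum becomes \<open>m\<close>.
\<close>

lemma power_conjugate_even:
  assumes "power_conjugate (E j i) (E j' i')" "even j"
  obtains m l :: nat where "odd m" "[j' = j * m] (mod 2 ^ \<beta>)" "[i' = i * int m * r ^ l] (mod 2 ^ (c + 1))"
proof -
  obtain m l :: nat and k :: int where m: "odd m" "[j' = j * m] (mod 2 ^ \<beta>)"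
    and k: "[k * r ^ j' + i' = i * geom_sum (r ^ j) m * r ^ l + k] (mod 2 ^ n)"
    using power_conjugateD[OF assms(1)] by metis
  have "even j'" using power_conjugate_parity(1)[OF assms(1)] assms(2) by simp
  have "[k + i' = k * r ^ j' + i'] (mod 2 ^ (c + 1))"
    using cong_mult[OF cong_refl[of k] r_even_power[OF \<open>even j'\<close>]] by (simp add: cong_add_rcancel cong_sym)
  also have "[k * r ^ j' + i' = i * geom_sum (r ^ j) m * r ^ l + k] (mod 2 ^ (c + 1))"
    using k c_less_n by (intro cong_pow2_le[OF k]) simp
  also have "[i * geom_sum (r ^ j) m * r ^ l + k = i * int m * r ^ l + k] (mod 2 ^ (c + 1))"
    using geom_sum_cong[OF r_even_power[OF assms(2)], of m]
    by (intro cong_add cong_mult cong_refl)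
  finally have "[k + i' = k + i * int m * r ^ l] (mod 2 ^ (c + 1))"
    by (simp only: add.commute)
  then have "[i' = i * int m * r ^ l] (mod 2 ^ (c + 1))"
    by (simp only: cong_add_lcancel)
  then show ?thesis using m that by blast
qed

lemma non_squareI:
  assumes "\<And>l k. [j = 2 * l] (mod 2 ^ \<beta>) \<Longrightarrow> [i = k * (r ^ l + 1)] (mod 2 ^ n) \<Longrightarrow> False"
  shows "E j i \<in> non_squares"
proof -
  have False if g: "g \<in> carrier G" "E j i = g \<otimes> g" for g
  proof -
    obtain l k where "g = E l k" using E_surj[OF g(1)] by blast
    then have "E j i = E (l + l) (k * r ^ l + k)" using g(2) by (simp add: E_mult)
    then have "E j i = E (2 * l) (k * (r ^ l + 1))"
      by (simp only: mult_2 distrib_left mult_1_right)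
    from E_eqD[OF this] show False using assms by blast
  qed
  then show ?thesis by (auto simp: non_squares_def)
qed

section \<open>Inequivalent non-squares\<close>

text \<open>
  The values of \<open>j\<close> for the representatives \<open>y\<^sup>j x\<close>. The factor 5 is outside of both possible groups
  \<open>{1, 3}\<close> and \<open>{1, 7}\<close> of powers of \<open>r\<close> modulo 8. It is visible only if \<open>j = 2\<^sup>k t\<close> leaves three binary
  digits of \<open>t\<close> modulo \<open>2\<^sup>\<beta>\<close>, that is, if \<open>k + 3 \<le> \<beta>\<close>.
\<close>

definition mixed_parity_exponents :: "nat set" where
  "mixed_parity_exponents = insert 0 ((\<lambda>k. 2 ^ k) ` {1..<\<beta>} \<union> (\<lambda>k. 5 * 2 ^ k) ` {1..<\<beta> - 2})"

text \<open>
  The values of \<open>i\<close> for the representatives \<open>y\<^sup>2 x\<^sup>i\<close>. The extra value is \<open>2 * 3\<close>: if \<open>c \<ge> 3\<close>, then 3 is not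
  a power of \<open>r\<close> modulo 8, and if \<open>\<beta> \<ge> 4\<close>, the odd powers that fix the coordinate 2 of \<open>y\<close>
  have exponent 1 modulo 8.
\<close>

definition even_exponents :: "int set" where
  "even_exponents = (\<lambda>k. 2 ^ k) ` {1..<c} \<union> (if 3 \<le> c \<and> 4 \<le> \<beta> then {6} else {})"

definition reps :: "(nat \<times> int) set" where
  "reps = {1} \<times> {0, 1} \<union> mixed_parity_exponents \<times> {1} \<union> {2} \<times> even_exponents"

lemma mixed_parity_exponents_even: "j \<in> mixed_parity_exponents \<Longrightarrow> even j"
  by (auto simp: mixed_parity_exponents_def)

lemma even_exponents_even: "i \<in> even_exponents \<Longrightarrow> even i"
  by (auto simp: even_exponents_def split: if_splits)

text \<open>
  In a square both coordinates are even, which leaves the representatives with \<open>j = 2\<close>.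
  A square with coordinate \<open>j = 2\<close> is the square of some \<open>y\<^sup>l x\<^sup>k\<close> with \<open>l\<close> odd. Then \<open>r\<^sup>l + 1\<close> is
  divisible by \<open>2\<^sup>c\<close>, and so is \<open>i\<close>, but no member of \<open>even_exponents\<close> is.
\<close>

lemma reps_non_squares:
  assumes "(j, i) \<in> reps"
  shows "E j i \<in> non_squares"
proof (rule non_squareI)
  fix l k
  assume j: "[j = 2 * l] (mod 2 ^ \<beta>)" and i: "[i = k * (r ^ l + 1)] (mod 2 ^ n)"
  have "even j" using odd_cong_nat[OF j] \<beta> by simp
  moreover have "even i" using odd_cong[OF i] c_less_n odd_r by simp
  ultimately have "j = 2" "i \<in> even_exponents"
    using assms by (auto simp: reps_def)
  have "[2 = 2 * l] (mod 2 ^ 2)" using j \<beta> \<open>j = 2\<close> by (meson cong_dvd_modulus_nat le_imp_power_dvd)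
  then have "odd l" by (auto simp: cong_def elim!: evenE)
  have "2 ^ c dvd r ^ l + 1"
    using twist_odd_power[of c l] c \<open>odd l\<close> by (simp add: r_eq cong_iff_dvd_diff)
  moreover have "[i = k * (r ^ l + 1)] (mod 2 ^ c)" using cong_pow2_le[OF i] c_less_n by simp
  ultimately have dvd: "2 ^ c dvd i" by (metis cong_dvd_iff dvd_mult)
  consider k where "k < c" "i = 2 ^ k" | "3 \<le> c" "i = 6"
    using \<open>i \<in> even_exponents\<close> by (auto simp: even_exponents_def split: if_splits)
  then show False
  proof cases
    case 1
    then show False using zdvd_imp_le[OF dvd] by simp
  next
    case 2
    then have "(2::int) ^ 3 dvd 6" using dvd le_imp_power_dvd dvd_trans by blast
    then show False by simp
  qed
qed

lemma r_mod_8: "[r = 3] (mod 8) \<and> c = 2 \<or> [r = - 1] (mod 8) \<and> 3 \<le> c"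
proof (cases "c = 2")
  case False
  then have "3 \<le> c" using c by simp
  then have "(2::int) ^ 3 dvd 2 ^ c" by (rule le_imp_power_dvd)
  then show ?thesis using \<open>3 \<le> c\<close> by (simp add: r_eq cong_iff_dvd_diff)
qed (simp add: r_eq)

lemma r_power_mod_8: "[r ^ l = 1] (mod 8) \<or> [r ^ l = r] (mod 8)"
proof -
  have "[r * r = 1] (mod 8)"
    using r_even_power[of 2] c cong_pow2_le[of "r * r" 1 "c + 1" 3] by (simp add: power2_eq_square)
  have "[r ^ l = (if even l then 1 else r)] (mod 8)"
  proof (induction l)
    case (Suc l)
    have "[r ^ Suc l = r * (if even l then 1 else r)] (mod 8)"
      using cong_mult[OF cong_refl[of r] Suc] by simp
    then show ?case using \<open>[r * r = 1] (mod 8)\<close> cong_trans by auto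
  qed simp
  then show ?thesis by (simp split: if_splits)
qed

text \<open>
  Since the coordinate of \<open>x\<close> is 1 on both sides, \<open>m r\<^sup>l\<close> is 1 modulo 8, so that \<open>m\<close> is not 5 modulo 8.
  But \<open>j' = j m\<close> modulo \<open>2\<^sup>\<beta>\<close>, where \<open>j\<close> and \<open>j'\<close> are powers of two or 5 times such powers.
\<close>

lemma mixed_parity_exponents_inequivalent:
  assumes "power_conjugate (E j 1) (E j' 1)" "j \<in> mixed_parity_exponents" "j' \<in> mixed_parity_exponents"
  shows "j = j'"
proof -
  obtain m l :: nat where m: "odd m" and j': "[j' = j * m] (mod 2 ^ \<beta>)"
    and ml: "[1 = 1 * int m * r ^ l] (mod 2 ^ (c + 1))"
    using power_conjugate_even[OF assms(1)] mixed_parity_exponents_even[OF assms(2)] by metis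
  have ml8: "[1 = int m * r ^ l] (mod 8)" using cong_pow2_le[OF ml, of 3] c by simp
  have m5: "\<not> [int m = 5] (mod 8)"
  proof
    assume "[int m = 5] (mod 8)"
    then have "[1 = 5 * r ^ l] (mod 8)" using ml8 cong_scalar_right cong_trans by blast
    moreover have "[r ^ l = 1] (mod 8) \<or> [r ^ l = 3] (mod 8) \<or> [r ^ l = - 1] (mod 8)"
      using r_power_mod_8[of l] r_mod_8 cong_trans by blast
    then have "[5 * r ^ l = 5] (mod 8) \<or> [5 * r ^ l = 15] (mod 8) \<or> [5 * r ^ l = - 5] (mod 8)"
      using cong_scalar_left[of "r ^ l" 1 8 5] cong_scalar_left[of "r ^ l" 3 8 5]
        cong_scalar_left[of "r ^ l" "- 1" 8 5] by fastforce
    ultimately have "[1 = (5::int)] (mod 8) \<or> [1 = (15::int)] (mod 8) \<or> [1 = (- 5::int)] (mod 8)"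
      using cong_trans by blast
    then show False by (simp add: cong_def)
  qed
  have shape: "j = 0 \<or> (\<exists>k t. j = 2 ^ k * t \<and> k < \<beta> \<and> (t = 1 \<or> t = 5 \<and> k + 3 \<le> \<beta>))"
    if j: "j \<in> mixed_parity_exponents" for j
  proof -
    consider (zero) "j = 0" | (pow) k where "j = 2 ^ k * 1" "k < \<beta>"
      | (five) k where "j = 2 ^ k * 5" "k < \<beta>" "k + 3 \<le> \<beta>"
    proof -
      have "j = 0 \<or> (\<exists>k\<in>{1..<\<beta>}. j = 2 ^ k) \<or> (\<exists>k\<in>{1..<\<beta> - 2}. j = 5 * 2 ^ k)"
        using j by (auto simp: mixed_parity_exponents_def)
      then show thesis by (elim disjE bexE) (auto intro: zero pow five simp: mult.commute)
    qed
    then show ?thesis by cases blast+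
  qed
  have zero: "\<not> [0 = 2 ^ k * u] (mod (2::nat) ^ \<beta>)" if "k < \<beta>" "odd u" for k u
  proof
    assume "[0 = 2 ^ k * u] (mod (2::nat) ^ \<beta>)"
    then have "2 ^ \<beta> dvd 2 ^ k * u" using cong_0_iff cong_sym by blast
    moreover have "(2::nat) ^ Suc k dvd 2 ^ \<beta>" using \<open>k < \<beta>\<close> by (intro le_imp_power_dvd) simp
    ultimately have "2 ^ Suc k dvd 2 ^ k * u" by (rule dvd_trans[rotated])
    then show False using \<open>odd u\<close> by simp
  qed
  have nz: "k = k' \<and> t = t'"
    if "k < \<beta>" "t = 1 \<or> t = 5 \<and> k + 3 \<le> \<beta>" "k' < \<beta>" "t' = 1 \<or> t' = 5 \<and> k' + 3 \<le> \<beta>"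
      "[2 ^ k' * t' = 2 ^ k * t * m] (mod 2 ^ \<beta>)" for k k' t t' :: nat
  proof -
    have cong: "[2 ^ k' * int t' = 2 ^ k * (int t * int m)] (mod 2 ^ \<beta>)"
      using that(5) by (simp flip: cong_int_iff add: mult.assoc)
    have odds: "odd (int t')" "odd (int t * int m)" using that(2,4) m by auto
    note k = pow2_odd_cong[OF cong odds \<open>k' < \<beta>\<close>]
    have "t = t'"
    proof (rule ccontr)
      assume "t \<noteq> t'"
      then have "k + 3 \<le> \<beta>" and t: "t = 1 \<and> t' = 5 \<or> t = 5 \<and> t' = 1" using that(2,4) k(1) by auto
      then have m8: "[int t' = int t * int m] (mod 8)"
        using cong_pow2_le[OF k(2), of 3] k(1) by simp
      from t show False
      proof
        assume "t = 1 \<and> t' = 5"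
        then show False using m5 m8 cong_sym by auto
      next
        assume "t = 5 \<and> t' = 1"
        then have "[5 * int m = 1] (mod 8)" using cong_sym[OF m8] by simp
        from cong_scalar_left[OF this, of 5] have "[5 * (5 * int m) = 5] (mod 8)" by simp
        \<comment> \<open>The inverse of 5 modulo 8 is 5.\<close>
        moreover have "int m - 5 * (5 * int m) = 8 * (- 3 * int m)" by simp
        then have "[int m = 5 * (5 * int m)] (mod 8)"
          unfolding cong_iff_dvd_diff by (metis dvd_triv_left)
        ultimately show False using m5 cong_trans by blast
      qed
    qed
    then show ?thesis using k(1) by simp
  qed
  show ?thesis
  proof (cases "j = 0")
    case True
    then have j'0: "[0 = j'] (mod 2 ^ \<beta>)" using j' by (simp add: cong_sym)
    from shape[OF assms(3)] show ?thesis
    proof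
      assume "\<exists>k t. j' = 2 ^ k * t \<and> k < \<beta> \<and> (t = 1 \<or> t = 5 \<and> k + 3 \<le> \<beta>)"
      then obtain k t where "j' = 2 ^ k * t" "k < \<beta>" "t = 1 \<or> t = 5 \<and> k + 3 \<le> \<beta>" by blast
      then show ?thesis using zero[of k t] j'0 by auto
    qed (use True in simp)
  next
    case False
    then obtain k t where j: "j = 2 ^ k * t" "k < \<beta>" "t = 1 \<or> t = 5 \<and> k + 3 \<le> \<beta>"
      using shape[OF assms(2)] by blast
    have "j' \<noteq> 0"
    proof
      assume "j' = 0"
      then have "[0 = 2 ^ k * (t * m)] (mod 2 ^ \<beta>)" using j' j(1) by (simp add: mult.assoc)
      moreover have "odd (t * m)" using j(3) m by auto
      ultimately show False using zero j(2) by blast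
    qed
    then obtain k' t' where "j' = 2 ^ k' * t'" "k' < \<beta>" "t' = 1 \<or> t' = 5 \<and> k' + 3 \<le> \<beta>"
      using shape[OF assms(3)] by blast
    then show ?thesis using nz[of k t k' t'] j j' by simp
  qed
qed

text \<open>
  The odd parts of \<open>i\<close> and \<open>i'\<close> differ by the factor \<open>m r\<^sup>l\<close>. If one of them is 3 and the other is 1,
  then \<open>m\<close> is 1 and \<open>r\<close> is \<open>-1\<close> modulo 8, a contradiction.
\<close>

lemma even_exponents_inequivalent:
  assumes "power_conjugate (E 2 i) (E 2 i')" "i \<in> even_exponents" "i' \<in> even_exponents"
  shows "i = i'"
proof -
  obtain m l :: nat where m: "odd m" and m2: "[2 = 2 * m] (mod 2 ^ \<beta>)"
    and i': "[i' = i * int m * r ^ l] (mod 2 ^ (c + 1))"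
    using power_conjugate_even[OF assms(1)] by (metis even_numeral)
  have shape: "\<exists>k t. i = 2 ^ k * t \<and> k < c \<and> (t = 1 \<or> t = 3 \<and> k = 1 \<and> 3 \<le> c \<and> 4 \<le> \<beta>)"
    if i: "i \<in> even_exponents" for i
  proof (cases "i = 6")
    case True
    then have "3 \<le> c" "4 \<le> \<beta>" using i by (auto simp: even_exponents_def split: if_splits)
    then show ?thesis using True by (intro exI[of _ 1] exI[of _ 3]) simp
  next
    case False
    then obtain k where "i = 2 ^ k" "k < c" using i by (auto simp: even_exponents_def split: if_splits)
    then show ?thesis by (intro exI[of _ k] exI[of _ 1]) simp
  qed
  obtain k t where k: "i = 2 ^ k * t" "k < c" "t = 1 \<or> t = 3 \<and> k = 1 \<and> 3 \<le> c \<and> 4 \<le> \<beta>"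
    using shape[OF assms(2)] by blast
  obtain k' t' where k': "i' = 2 ^ k' * t'" "k' < c"
      "t' = 1 \<or> t' = 3 \<and> k' = 1 \<and> 3 \<le> c \<and> 4 \<le> \<beta>"
    using shape[OF assms(3)] by blast
  have cong: "[2 ^ k' * t' = 2 ^ k * (t * int m * r ^ l)] (mod 2 ^ (c + 1))"
    using i' k(1) k'(1) by (simp add: mult.assoc)
  have odds: "odd t'" "odd (t * int m * r ^ l)" using k(3) k'(3) m odd_r by auto
  have "k' < c + 1" using k'(2) by simp
  note * = pow2_odd_cong[OF cong odds this]
  have "t = t'"
  proof (rule ccontr)
    assume "t \<noteq> t'"
    then have t: "t = 1 \<and> t' = 3 \<or> t = 3 \<and> t' = 1" and c3: "k' = 1" "3 \<le> c" "4 \<le> \<beta>"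
      using k(3) k'(3) *(1) by auto
    have "[2 ^ 1 * 1 = 2 ^ 1 * int m] (mod 2 ^ \<beta>)" using m2 by (simp flip: cong_int_iff)
    from pow2_odd_cong(2)[OF this] have "[1 = int m] (mod 2 ^ (\<beta> - 1))" using m \<beta> by simp
    then have m8: "[int m = 1] (mod 8)" using cong_pow2_le[of 1 "int m" "\<beta> - 1" 3] c3 by (simp add: cong_sym)
    have "[r = - 1] (mod 8)" using r_mod_8 c3 by auto
    then have "[r ^ l = 1] (mod 8) \<or> [r ^ l = - 1] (mod 8)"
      using r_power_mod_8[of l] cong_trans by blast
    then have "[int m * r ^ l = 1] (mod 8) \<or> [int m * r ^ l = - 1] (mod 8)"
      using cong_mult[OF m8, of "r ^ l" 1] cong_mult[OF m8, of "r ^ l" "- 1"] by auto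
    then have "[t * (int m * r ^ l) = t] (mod 8) \<or> [t * (int m * r ^ l) = - t] (mod 8)"
      using cong_scalar_left[of "int m * r ^ l" _ 8 t] by fastforce
    moreover have "[t' = t * (int m * r ^ l)] (mod 8)"
      using cong_pow2_le[OF *(2), of 3] c3 by (simp add: mult.assoc)
    ultimately have "[t' = t] (mod 8) \<or> [t' = - t] (mod 8)" using cong_trans by blast
    then show False using t by (auto simp: cong_def)
  qed
  then show ?thesis using *(1) k(1) k'(1) by simp
qed

lemma reps_inequivalent:
  assumes "(j, i) \<in> reps" "(j', i') \<in> reps" "power_conjugate (E j i) (E j' i')"
  shows "(j, i) = (j', i')"
proof -
  note parity = power_conjugate_parity[OF assms(3)]
  consider "j = 1" "i = 0 \<or> i = 1" | "j \<in> mixed_parity_exponents" "i = 1" | "j = 2" "i \<in> even_exponents"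
    using assms(1) by (auto simp: reps_def)
  then show ?thesis
  proof cases
    case 1
    then have "j' = 1" "i' = 0 \<or> i' = 1"
      using parity(1) assms(2) mixed_parity_exponents_even by (auto simp: reps_def)
    then show ?thesis using 1 parity(2) by auto
  next
    case 2
    then have "j' \<in> mixed_parity_exponents" "i' = 1"
      using parity assms(2) mixed_parity_exponents_even even_exponents_even by (auto simp: reps_def)
    then show ?thesis using 2 assms(3) mixed_parity_exponents_inequivalent by auto
  next
    case 3
    then have "j' = 2" "i' \<in> even_exponents"
      using parity assms(2) mixed_parity_exponents_even even_exponents_even by (auto simp: reps_def)
    then show ?thesis using 3 assms(3) even_exponents_inequivalent by auto
  qed
qed

lemma card_mixed_parity_exponents: "card mixed_parity_exponents = \<beta> + (\<beta> - 3)"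
proof -
  have "inj_on (\<lambda>k. (2::nat) ^ k) {1..<\<beta>}" "inj_on (\<lambda>k. 5 * (2::nat) ^ k) {1..<\<beta> - 2}"
    by (auto intro!: inj_onI)
  then have cards: "card ((\<lambda>k. (2::nat) ^ k) ` {1..<\<beta>}) = \<beta> - 1"
    "card ((\<lambda>k. 5 * (2::nat) ^ k) ` {1..<\<beta> - 2}) = \<beta> - 3"
    by (simp_all add: card_image)
  have "False" if "(2::nat) ^ k = 5 * 2 ^ l" for k l
  proof -
    have "(2::int) ^ k * 1 = 2 ^ l * 5" using arg_cong[OF that, of int] by simp
    from pow2_odd_unique[OF this] show False using that by simp
  qed
  then have "card ((\<lambda>k. (2::nat) ^ k) ` {1..<\<beta>} \<union> (\<lambda>k. 5 * (2::nat) ^ k) ` {1..<\<beta> - 2})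
      = (\<beta> - 1) + (\<beta> - 3)"
    unfolding cards[symmetric] by (intro card_Un_disjoint) auto
  moreover have "0 \<notin> (\<lambda>k. (2::nat) ^ k) ` {1..<\<beta>} \<union> (\<lambda>k. 5 * (2::nat) ^ k) ` {1..<\<beta> - 2}" by auto
  ultimately show ?thesis using \<beta> by (simp add: mixed_parity_exponents_def)
qed

lemma card_even_exponents: "card even_exponents = c - 1 + of_bool (3 \<le> c \<and> 4 \<le> \<beta>)"
proof -
  have "inj_on (\<lambda>k. (2::int) ^ k) {1..<c}" by (auto intro!: inj_onI)
  then have "card ((\<lambda>k. (2::int) ^ k) ` {1..<c}) = c - 1" by (simp add: card_image)
  moreover have "6 \<notin> (\<lambda>k. (2::int) ^ k) ` {1..<c}" by auto
  ultimately show ?thesis using c by (simp add: even_exponents_def)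
qed

lemma card_reps: "card reps = 2 + (\<beta> + (\<beta> - 3)) + (c - 1 + of_bool (3 \<le> c \<and> 4 \<le> \<beta>))"
proof -
  have fin: "finite mixed_parity_exponents" "finite even_exponents"
    by (auto simp: mixed_parity_exponents_def even_exponents_def)
  have "1 \<notin> even_exponents" "1 \<notin> mixed_parity_exponents" using even_exponents_even mixed_parity_exponents_even by force+
  then have "card reps = card ({1::nat} \<times> {0, 1::int}) + card (mixed_parity_exponents \<times> {1::int})
      + card ({2::nat} \<times> even_exponents)"
    unfolding reps_def using fin by (subst card_Un_disjoint; force)+
  then show ?thesis by (simp add: card_cartesian_product card_mixed_parity_exponents card_even_exponents)
qed

lemma E_inj_on_reps: "inj_on (\<lambda>(j, i). E j i) reps"
proof (rule inj_onI, clarify)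
  fix j i j' i'
  assume *: "(j, i) \<in> reps" "(j', i') \<in> reps" "E j i = E j' i'"
  then have "power_conjugate (E j i) (E j' i')"
    using conj_class_subgroup_eq_iff[OF E_closed E_closed, of j i j' i'] by simp
  then show "j = j' \<and> i = i'" using reps_inequivalent * by blast
qed

theorem card_reps_le_eta: "card reps \<le> eta G"
proof -
  have "card ((\<lambda>(j, i). E j i) ` reps) \<le> eta G"
  proof (rule eta_lower_bound[OF nontrivial])
    show "(\<lambda>(j, i). E j i) ` reps \<subseteq> non_squares" using reps_non_squares by auto
    fix x y
    assume "x \<in> (\<lambda>(j, i). E j i) ` reps" "y \<in> (\<lambda>(j, i). E j i) ` reps" "power_conjugate x y"
    then show "x = y" using reps_inequivalent by auto
  qed
  then show ?thesis using E_inj_on_reps by (simp add: card_image)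
qed

end

section \<open>Completeness of the representatives\<close>

text \<open>
  The moduli of uniqueness now equal the periods, so that the elements correspond to the pairs of
  residues. This is the case \<open>\<epsilon> = 0\<close> of the metacyclic groups.
\<close>

locale faithful_twisted_coordinates =
  twisted_coordinates G E r n \<beta> c \<beta> n for G (structure) and E r n \<beta> c
begin

lemma power_conjugate_conj:
  "power_conjugate (E j i) (E j (i * r ^ l + k * (1 - r ^ j)))"
proof -
  have "E l k \<otimes> E j (i * r ^ l + k * (1 - r ^ j)) = E j i [^] (1::nat) \<otimes> E l k"
    by (simp add: E_mult algebra_simps)
  then show ?thesis unfolding power_conjugate_def by (metis E_closed odd_one)
qed

lemma power_conjugate_pow:
  "odd m \<Longrightarrow> power_conjugate (E j i) (E (j * m) (i * geom_sum (r ^ j) m))"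
  unfolding E_pow[symmetric] power_conjugate_def
  by (metis E_closed l_one nat_pow_closed one_closed r_one)

lemma power_conjugate_conj_pow:
  assumes "odd m"
  shows "power_conjugate (E j i) (E (j * m) (i * r ^ l * geom_sum (r ^ j) m))"
proof -
  have "power_conjugate (E j i) (E j (i * r ^ l))"
    using power_conjugate_conj[of j i l 0] by simp
  then show ?thesis
    using power_conjugate_pow[OF assms, of j "i * r ^ l"] power_conjugate_trans E_closed by blast
qed

lemma r_even_power_mod_4: "even j \<Longrightarrow> [r ^ j = 1] (mod 4)"
  using cong_pow2_le[OF r_even_power, of j 2] c by simp

lemma geom_sum_mod_4: "even j \<Longrightarrow> [geom_sum (r ^ j) m = int m] (mod 4)"
  using geom_sum_cong r_even_power_mod_4 by blast

lemma geom_sum_mod_8: "even j \<Longrightarrow> [geom_sum (r ^ j) m = int m] (mod 8)"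
  using cong_pow2_le[OF r_even_power, of j 3] c by (intro geom_sum_cong) simp

lemma odd_geom_sum_iff: "even j \<Longrightarrow> odd (geom_sum (r ^ j) m) \<longleftrightarrow> odd m"
  using odd_cong[of "geom_sum (r ^ j) m" "int m" 2] geom_sum_mod_4[of j m] by simp

lemma r_mod_4: "[r = 3] (mod 4)"
  using r_mod_8
proof
  assume "[r = 3] (mod 8) \<and> c = 2"
  then show ?thesis using cong_pow2_le[of r 3 3 2] by simp
next
  assume "[r = - 1] (mod 8) \<and> 3 \<le> c"
  then have "[r = - 1] (mod 4)" using cong_pow2_le[of r "- 1" 3 2] by simp
  then show ?thesis by (simp add: cong_def)
qed

text \<open>
  As \<open>r\<close> is 3 modulo 4, \<open>l = 0\<close> or \<open>l = 1\<close> works.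
\<close>

lemma twist_to_one_mod_4:
  assumes "odd u"
  obtains l where "[u * r ^ l = 1] (mod 4)"
proof (cases "[u = 1] (mod 4)")
  case True
  then show ?thesis using that[of 0] by simp
next
  case False
  then have "[u = 3] (mod 4)" using odd_mod_4 assms by blast
  from cong_mult[OF this r_mod_4] have "[u * r ^ 1 = 1] (mod 4)" by (simp add: cong_def)
  then show ?thesis by (rule that)
qed

text \<open>
  Since \<open>r\<^sup>j\<close> is 1 modulo 4, the geometric sums take every value modulo \<open>2\<^sup>n\<close>; a sum is odd only if its
  number of terms is.
\<close>

lemma normalise_coordinate:
  assumes "even j" "odd u"
  obtains m where "odd m" "[u * geom_sum (r ^ j) m = 1] (mod 2 ^ n)"
proof -
  obtain m where m: "[u * geom_sum (r ^ j) m = 1] (mod 2 ^ n)"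
    using solve_geom_sum[OF r_even_power_mod_4[OF assms(1)] assms(2)] by blast
  then have "odd (u * geom_sum (r ^ j) m)" using odd_cong[OF m] c_less_n by simp
  then have "odd m" using odd_geom_sum_iff[OF assms(1)] by simp
  then show ?thesis using m that by blast
qed

text \<open>
  A power makes \<open>j = 1\<close>. Conjugation by \<open>x\<^sup>k\<close> then adds \<open>k (1 - r)\<close> to \<open>i\<close>, and \<open>1 - r\<close> is
  twice an odd number, so that only the parity of \<open>i\<close> matters.
\<close>

lemma odd_class:
  assumes "odd j"
  shows "\<exists>(j', i') \<in> reps. power_conjugate (E j i) (E j' i')"
proof -
  obtain m where m: "[j * m = 1] (mod 2 ^ \<beta>)" using solve_linear_pow2_nat[OF assms] by metis
  then have "odd m" using odd_cong_nat[OF m] \<beta> by simp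
  define i' where "i' = i * geom_sum (r ^ j) m"
  have 1: "power_conjugate (E j i) (E 1 i')"
    using power_conjugate_pow[OF \<open>odd m\<close>, of j i] E_cong[OF m cong_refl] by (simp add: i'_def)
  define e where "e = i' mod 2"
  obtain w where w: "i' = e + 2 * w" using that[of "i' div 2"] by (simp add: e_def)
  have "odd (1 - (2::int) ^ (c - 1))" using c by simp
  then obtain k where k: "[(1 - 2 ^ (c - 1)) * k = - w] (mod 2 ^ n)" using solve_linear_pow2 by blast
  have "(2::int) ^ c = 2 * 2 ^ (c - 1)" using c by (simp flip: power_Suc)
  then have r: "1 - r = 2 * (1 - 2 ^ (c - 1))" by (simp add: r_eq)
  have "[i' + 2 * ((1 - 2 ^ (c - 1)) * k) = i' + 2 * (- w)] (mod 2 ^ n)"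
    using k by (intro cong_add cong_mult cong_refl)
  then have "[i' * r ^ 0 + k * (1 - r ^ 1) = e] (mod 2 ^ n)" using w r by (simp add: algebra_simps)
  then have "power_conjugate (E 1 i') (E 1 e)"
    using power_conjugate_conj[of 1 i' 0 k] E_cong[OF cong_refl[of 1]] by metis
  then have "power_conjugate (E j i) (E 1 e)"
    using 1 power_conjugate_trans E_closed by blast
  moreover have "(1, e) \<in> reps" by (auto simp: reps_def e_def)
  ultimately show ?thesis by blast
qed

text \<open>
  Because \<open>k \<ge> 1\<close> and \<open>j\<close> counts modulo 8, only \<open>t\<close> modulo 4 matters. Conjugation by \<open>y\<^sup>l\<close> and the
  power that restores \<open>i = 1\<close> multiply \<open>j\<close> by the inverse of \<open>r\<^sup>l\<close> modulo 4, which can be chosen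
  to be the inverse of \<open>t\<close>.
\<close>

lemma mixed_parity_class_beta_3:
  assumes "\<beta> = 3" "odd t" "1 \<le> k"
  shows "power_conjugate (E (2 ^ k * t) 1) (E (2 ^ k) 1)"
proof -
  let ?j = "2 ^ k * t"
  have "even ?j" using assms by simp
  obtain l where l: "[int t * r ^ l = 1] (mod 4)" using twist_to_one_mod_4[of "int t"] assms by auto
  obtain m where m: "odd m" "[r ^ l * geom_sum (r ^ ?j) m = 1] (mod 2 ^ n)"
    using normalise_coordinate[OF \<open>even ?j\<close>, of "r ^ l"] odd_r by auto
  have "[r ^ l * geom_sum (r ^ ?j) m = 1] (mod 4)" using cong_pow2_le[OF m(2), of 2] c c_less_n by simp
  moreover have "[r ^ l * geom_sum (r ^ ?j) m = r ^ l * int m] (mod 4)"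
    using geom_sum_mod_4[OF \<open>even ?j\<close>] cong_scalar_left by blast
  ultimately have "[r ^ l * int m = 1] (mod 4)" using cong_sym cong_trans by blast
  then have "[int t * (r ^ l * int m) = int t * 1] (mod 4)" using cong_scalar_left by blast
  moreover have "[int t * r ^ l * int m = 1 * int m] (mod 4)" using l cong_scalar_right by blast
  ultimately have mt: "[int m = int t] (mod 4)"
    by (metis cong_sym cong_trans mult.assoc mult_1 mult.right_neutral)
  have "[int t * int t = 1] (mod 4)" using odd_square_mod_4[of "int t"] assms(2) by simp
  then have "[int t * int m = 1] (mod 4)" using mt cong_scalar_left cong_trans by blast
  then obtain d where d: "int t * int m - 1 = 4 * d" by (auto simp: cong_iff_dvd_diff dvd_def)
  \<comment> \<open>The factor 2 from \<open>k \<ge> 1\<close> raises the congruence from modulus 4 to modulus 8.\<close>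
  obtain e where e: "k = Suc e" using assms(3) by (cases k) auto
  have "int (?j * m) - int (2 ^ k) = 2 ^ k * (int t * int m - 1)" by (simp add: algebra_simps)
  also have "\<dots> = 2 ^ 3 * (2 ^ e * d)" unfolding d e by simp
  finally have "int (?j * m) - int (2 ^ k) = 2 ^ 3 * (2 ^ e * d)" .
  then have "[int (?j * m) = int (2 ^ k)] (mod int (2 ^ \<beta>))"
    unfolding cong_iff_dvd_diff assms(1) by simp
  then have "[?j * m = 2 ^ k] (mod 2 ^ \<beta>)" by (simp only: cong_int_iff)
  then have "E (?j * m) (1 * r ^ l * geom_sum (r ^ ?j) m) = E (2 ^ k) 1"
    using m(2) by (intro E_cong) simp_all
  then show ?thesis using power_conjugate_conj_pow[OF m(1), of ?j 1 l] by simp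
qed

text \<open>
  Let \<open>m\<close> be odd and 1 or 3 modulo 8. The \<open>m\<close>-th power multiplies \<open>i\<close> by a geometric sum with the same
  residue modulo 8, hence by a power of \<open>r = 3\<close>, and a conjugation by some \<open>y\<^sup>l\<close> makes up for it. So
  \<open>t\<close> can be multiplied by every such \<open>m\<close>. Either the inverse of \<open>t\<close> or 5 times the inverse is
  such an \<open>m\<close>, and \<open>t\<close> becomes 1 or 5.
\<close>

lemma mixed_parity_class_c_2:
  assumes "c = 2" "odd t" "1 \<le> k"
  shows "power_conjugate (E (2 ^ k * t) 1) (E (2 ^ k) 1) \<or>
    power_conjugate (E (2 ^ k * t) 1) (E (5 * 2 ^ k) 1)"
proof -
  let ?j = "2 ^ k * t"
  have "even ?j" using assms by simp
  have r: "r = 3" by (simp add: r_eq assms(1))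
  have reach: "power_conjugate (E ?j 1) (E (2 ^ k * s) 1)"
    if m: "odd m" "[t * m = s] (mod 2 ^ \<beta>)" "[int m = 1] (mod 8) \<or> [int m = 3] (mod 8)" for m s
  proof -
    let ?S = "geom_sum (r ^ ?j) m"
    have "[?S = 1] (mod 8) \<or> [?S = 3] (mod 8)"
      using m(3) geom_sum_mod_8[OF \<open>even ?j\<close>, of m] cong_trans by blast
    then obtain l where l: "[?S * 3 ^ l = 1] (mod 2 ^ n)" using solve_pow_three by blast
    then have l: "[1 * r ^ l * ?S = 1] (mod 2 ^ n)" by (simp add: r mult.commute)
    have "[2 ^ k * (t * m) = 2 ^ k * s] (mod 2 ^ \<beta>)" using m(2) cong_scalar_left by blast
    then have "E (?j * m) (1 * r ^ l * ?S) = E (2 ^ k * s) 1"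
      using l by (intro E_cong) (simp_all add: mult.assoc)
    then show ?thesis using power_conjugate_conj_pow[OF m(1), of ?j 1 l] by simp
  qed
  obtain m where m: "[t * m = 1] (mod 2 ^ \<beta>)" using solve_linear_pow2_nat[OF assms(2)] by metis
  then have "odd m" using odd_cong_nat[OF m] \<beta> by simp
  show ?thesis
  proof (cases "[int m = 1] (mod 8) \<or> [int m = 3] (mod 8)")
    case True
    then show ?thesis using reach[OF \<open>odd m\<close> m] by simp
  next
    case False
    then have "[int (5 * m) = 1] (mod 8) \<or> [int (5 * m) = 3] (mod 8)"
      using odd_mod_8[of "int m"] \<open>odd m\<close> by auto
    moreover have "[t * (5 * m) = 5] (mod 2 ^ \<beta>)"
      using cong_scalar_left[OF m, of 5] by (simp add: mult.left_commute)
    ultimately show ?thesis using reach[of "5 * m" 5] \<open>odd m\<close> by (simp add: mult.commute)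
  qed
qed

text \<open>
  A power leads to \<open>i = 1\<close>. If \<open>k + 3 > \<beta>\<close>, the exponents \<open>5 * 2\<^sup>k\<close> and \<open>2\<^sup>k\<close> agree modulo \<open>2\<^sup>\<beta>\<close>,
  so the representative with factor 5 is needed only in the range where it is listed.
\<close>

lemma mixed_parity_class:
  assumes "\<beta> = 3 \<or> c = 2" "even j" "odd i"
  shows "\<exists>(j', i') \<in> reps. power_conjugate (E j i) (E j' i')"
proof -
  obtain m where m: "odd m" "[i * geom_sum (r ^ j) m = 1] (mod 2 ^ n)"
    using normalise_coordinate assms by blast
  define j' where "j' = j * m mod 2 ^ \<beta>"
  have j': "j' < 2 ^ \<beta>" "even j'" using assms(2) \<beta> by (simp_all add: j'_def even_mod_2_iff dvd_mod)
  have "E (j * m) (i * geom_sum (r ^ j) m) = E j' 1"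
    using m(2) by (intro E_cong) (simp_all add: j'_def)
  then have 1: "power_conjugate (E j i) (E j' 1)" using power_conjugate_pow[OF m(1), of j i] by simp
  have "\<exists>s\<in>mixed_parity_exponents. power_conjugate (E j' 1) (E s 1)"
  proof (cases "j' = 0")
    case True
    then show ?thesis using conj_class_subgroup_eq_iff[OF E_closed E_closed, of j' 1 j' 1]
      by (auto simp: mixed_parity_exponents_def)
  next
    case False
    then obtain k t where kt: "j' = 2 ^ k * t" "odd t"
      by (metis multiplicity_decompose' odd_one)
    have "1 \<le> k" using kt j'(2) by (cases k) auto
    have "2 ^ k \<le> j'" using kt by (cases t) auto
    then have "(2::nat) ^ k < 2 ^ \<beta>" using j'(1) by linarith
    then have "k < \<beta>" by simp
    have one: "2 ^ k \<in> mixed_parity_exponents" using \<open>1 \<le> k\<close> \<open>k < \<beta>\<close> by (auto simp: mixed_parity_exponents_def)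
    show ?thesis
    proof (cases "power_conjugate (E j' 1) (E (2 ^ k) 1)")
      case False
      then have five: "power_conjugate (E j' 1) (E (5 * 2 ^ k) 1)"
        using assms(1) mixed_parity_class_beta_3 mixed_parity_class_c_2 kt \<open>1 \<le> k\<close> by blast
      have "k < \<beta> - 2"
      proof (rule ccontr)
        assume "\<not> k < \<beta> - 2"
        then have "(2::nat) ^ \<beta> dvd 2 ^ (k + 2)" by (intro le_imp_power_dvd) simp
        then have "[4 * 2 ^ k = 0] (mod (2::nat) ^ \<beta>)"
          by (simp add: cong_0_iff power_add mult.commute)
        from cong_add[OF cong_refl[of "2 ^ k"] this]
        have "[5 * 2 ^ k = 2 ^ k] (mod (2::nat) ^ \<beta>)" by simp
        then have "E (5 * 2 ^ k) 1 = E (2 ^ k) 1" by (intro E_cong) (simp_all add: mult.commute)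
        then show False using False five by simp
      qed
      then have "5 * 2 ^ k \<in> mixed_parity_exponents" using \<open>1 \<le> k\<close> by (auto simp: mixed_parity_exponents_def)
      then show ?thesis using five by blast
    qed (use one in blast)
  qed
  then obtain s where s: "s \<in> mixed_parity_exponents" "power_conjugate (E j' 1) (E s 1)" by blast
  have "power_conjugate (E j i) (E s 1)" using 1 s(2) power_conjugate_trans E_closed by blast
  moreover have "(s, 1) \<in> reps" using s(1) by (simp add: reps_def)
  ultimately show ?thesis by blast
qed

text \<open>
  For \<open>j = 2l\<close> with \<open>l\<close> even, \<open>r\<^sup>l + 1\<close> is twice an odd number, so \<open>i = k (r\<^sup>l + 1)\<close> can be solved
  for \<open>k\<close>, and \<open>y\<^sup>l x\<^sup>k\<close> is a square root.
\<close>

lemma square_if_4_dvd: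
  assumes "4 dvd j" "even i"
  shows "E j i \<notin> non_squares"
proof -
  obtain l where l: "j = 2 * l" "even l" using assms(1) by (auto elim!: dvdE simp: that)
  have "[r ^ l = 1] (mod 4)" using r_even_power_mod_4 l(2) by simp
  then obtain w where "r ^ l - 1 = 4 * w" by (auto simp: cong_iff_dvd_diff dvd_def)
  then have w: "r ^ l + 1 = 2 * (1 + 2 * w)" by simp
  have "odd (1 + 2 * w)" by simp
  then obtain k where k: "[(1 + 2 * w) * k = i div 2] (mod 2 ^ n)" using solve_linear_pow2 by blast
  then have "[2 * ((1 + 2 * w) * k) = 2 * (i div 2)] (mod 2 ^ n)" by (rule cong_scalar_left)
  moreover have "2 * ((1 + 2 * w) * k) = k * r ^ l + k"
    using arg_cong[OF w, of "\<lambda>x. k * x"] by (simp add: algebra_simps)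
  ultimately have "[i = k * r ^ l + k] (mod 2 ^ n)" using assms(2) by (simp add: cong_sym)
  then have "E j i = E l k \<otimes> E l k" unfolding E_mult using l(1) by (intro E_cong) (simp_all add: mult_2)
  then show ?thesis by (auto simp: non_squares_def)
qed

lemma square_if_pow2_c_dvd:
  assumes "2 ^ c dvd i"
  shows "E 2 i \<notin> non_squares"
proof -
  obtain k where "i = 2 ^ c * k" using assms by (auto elim: dvdE)
  then have "E 2 i = E 1 k \<otimes> E 1 k" by (simp add: E_mult r_eq algebra_simps numeral_2_eq_2)
  then show ?thesis by (auto simp: non_squares_def)
qed

text \<open>
  Conjugation by \<open>y\<^sup>l\<close> makes \<open>u\<close> equal to 1 modulo 4. The power \<open>m\<close> that turns it into 1 is then 1
  modulo 4 itself, and does not change \<open>j = 2\<close> modulo 8.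
\<close>

lemma even_class_beta_3:
  assumes "\<beta> = 3" "odd u"
  shows "power_conjugate (E 2 (2 ^ k * u)) (E 2 (2 ^ k))"
proof -
  obtain l where l: "[u * r ^ l = 1] (mod 4)" using twist_to_one_mod_4[OF assms(2)] by blast
  obtain m where m: "odd m" "[(u * r ^ l) * geom_sum (r ^ 2) m = 1] (mod 2 ^ n)"
    using normalise_coordinate[of 2 "u * r ^ l"] assms(2) odd_r by auto
  have "[u * r ^ l * geom_sum (r ^ 2) m = 1] (mod 4)" using cong_pow2_le[OF m(2), of 2] c c_less_n by simp
  moreover have "[u * r ^ l * geom_sum (r ^ 2) m = 1 * int m] (mod 4)"
    using geom_sum_mod_4[of 2 m] l by (intro cong_mult) simp_all
  ultimately have "[int m = 1] (mod 4)" using cong_sym cong_trans by (metis mult_1)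
  then obtain d where "int m - 1 = 4 * d" by (auto simp: cong_iff_dvd_diff dvd_def)
  then have "2 * int m - 2 = 8 * d" by simp
  then have "[2 * int m = 2] (mod 8)" by (simp add: cong_iff_dvd_diff)
  then have "[int (2 * m) = int 2] (mod int (2 ^ \<beta>))" by (simp add: assms(1))
  then have "[2 * m = 2] (mod 2 ^ \<beta>)" by (simp only: cong_int_iff)
  moreover have "[2 ^ k * ((u * r ^ l) * geom_sum (r ^ 2) m) = 2 ^ k * 1] (mod 2 ^ n)"
    using m(2) by (rule cong_scalar_left)
  ultimately have "E (2 * m) (2 ^ k * u * r ^ l * geom_sum (r ^ 2) m) = E 2 (2 ^ k)"
    by (intro E_cong) (simp_all add: mult.assoc)
  then show ?thesis using power_conjugate_conj_pow[OF m(1), of 2 "2 ^ k * u" l] by simp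
qed

text \<open>
  Conjugation by \<open>y\<^sup>l\<close> makes \<open>u\<close> equal to 1 modulo 4, and conjugation by \<open>x\<^sup>k\<close> adds the multiple
  \<open>k (1 - 3\<^sup>2)\<close> of 8 to \<open>2 u\<close>.
\<close>

lemma even_class_c_2:
  assumes "c = 2" "odd u"
  shows "power_conjugate (E 2 (2 * u)) (E 2 2)"
proof -
  have r: "r = 3" by (simp add: r_eq assms(1))
  obtain l where l: "[u * r ^ l = 1] (mod 4)" using twist_to_one_mod_4[OF assms(2)] by blast
  then obtain k where "u * r ^ l - 1 = 4 * k" by (auto simp: cong_iff_dvd_diff dvd_def)
  then have "2 * u * r ^ l + k * (1 - r ^ 2) = 2" by (simp add: r)
  then show ?thesis using power_conjugate_conj[of 2 "2 * u" l k] by simp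
qed

text \<open>
  Being a non-square is preserved by the relation. Hence \<open>j\<close> is an odd multiple of 2, a power leads to
  \<open>j = 2\<close>, and \<open>2\<^sup>c\<close> does not divide the resulting coordinate of \<open>x\<close>.
\<close>

lemma even_class:
  assumes "\<beta> = 3 \<or> c = 2" "even j" "even i" "E j i \<in> non_squares"
  shows "\<exists>(j', i') \<in> reps. power_conjugate (E j i) (E j' i')"
proof -
  obtain w where w: "j = 2 * w" using assms(2) by (rule evenE)
  have "odd w" using square_if_4_dvd[of j i] assms(3,4) w by (auto elim!: evenE)
  then obtain m where m: "[w * m = 1] (mod 2 ^ \<beta>)" using solve_linear_pow2_nat by metis
  then have "odd m" using odd_cong_nat[OF m] \<beta> by simp
  define i' where "i' = i * geom_sum (r ^ j) m"
  have "[2 * (w * m) = 2 * 1] (mod 2 ^ \<beta>)" using m by (rule cong_scalar_left)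
  then have "E (j * m) i' = E 2 i'" using w by (intro E_cong) (simp_all add: mult.assoc)
  then have 1: "power_conjugate (E j i) (E 2 i')"
    using power_conjugate_pow[OF \<open>odd m\<close>, of j i] by (simp add: i'_def)
  then have "\<not> 2 ^ c dvd i'"
    using non_squares_power_conjugate[OF assms(4) E_closed 1] square_if_pow2_c_dvd by blast
  then have "i' \<noteq> 0" by auto
  then obtain k u where ku: "i' = 2 ^ k * u" "odd u"
    by (metis multiplicity_decompose' odd_one)
  have "even i'" using assms(3) by (simp add: i'_def)
  then have "1 \<le> k" using ku by (cases k) auto
  have "k < c" using \<open>\<not> 2 ^ c dvd i'\<close> ku(1) by (meson dvd_mult2 le_imp_power_dvd not_le)
  have "power_conjugate (E 2 i') (E 2 (2 ^ k))"
    using assms(1)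
  proof
    assume "c = 2"
    then have "k = 1" using \<open>1 \<le> k\<close> \<open>k < c\<close> by simp
    then show ?thesis using even_class_c_2[OF \<open>c = 2\<close> ku(2)] ku(1) by simp
  qed (use even_class_beta_3 ku in simp)
  then have "power_conjugate (E j i) (E 2 (2 ^ k))"
    using 1 power_conjugate_trans E_closed by blast
  moreover have "(2, 2 ^ k) \<in> reps" using \<open>1 \<le> k\<close> \<open>k < c\<close> by (auto simp: reps_def even_exponents_def)
  ultimately show ?thesis by blast
qed

theorem eta_eq_card_reps:
  assumes "\<beta> = 3 \<or> c = 2"
  shows "eta G = card reps"
proof (rule antisym)
  have "eta G \<le> card ((\<lambda>(j, i). E j i) ` reps)"
  proof (rule eta_upper_bound[OF nontrivial])
    fix x assume x: "x \<in> non_squares"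
    then obtain j i where ji: "x = E j i" using E_surj[of x] by (auto simp: non_squares_def)
    have "\<exists>(j', i') \<in> reps. power_conjugate (E j i) (E j' i')"
      using odd_class mixed_parity_class[OF assms] even_class[OF assms] x ji by blast
    then show "\<exists>y\<in>(\<lambda>(j, i). E j i) ` reps. power_conjugate x y" unfolding ji by blast
  qed auto
  then show "eta G \<le> card reps" using E_inj_on_reps by (simp add: card_image)
qed (rule card_reps_le_eta)

end

section \<open>Coordinates in the presented group\<close>

text \<open>
  The multiplication of coordinates as an operation on pairs. It is associative before any reduction,
  so that words can be evaluated in the resulting monoid, and the group relations only have to hold up
  to a congruence.
\<close>

fun twist_mult :: "int \<Rightarrow> nat \<times> int \<Rightarrow> nat \<times> int \<Rightarrow> nat \<times> int" where
  "twist_mult r (j, i) (l, k) = (j + l, i * r ^ l + k)"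

lemma twist_mult_assoc: "twist_mult r (twist_mult r p q) s = twist_mult r p (twist_mult r q s)"
  by (cases p; cases q; cases s) (simp add: power_add algebra_simps)

text \<open>
  The first coordinate is a natural number, so the inverse of \<open>y\<close> is represented by \<open>d - 1\<close>, where \<open>d\<close> is
  the modulus of this coordinate.
\<close>

fun letter_coords :: "nat \<Rightarrow> metacyclic_gen \<times> bool \<Rightarrow> nat \<times> int" where
  "letter_coords d (Gen_x, True) = (0, 1)"
| "letter_coords d (Gen_x, False) = (0, - 1)"
| "letter_coords d (Gen_y, True) = (1, 0)"
| "letter_coords d (Gen_y, False) = (d - 1, 0)"

fun word_coords :: "int \<Rightarrow> nat \<Rightarrow> metacyclic_gen word \<Rightarrow> nat \<times> int" where
  "word_coords r d [] = (0, 0)"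
| "word_coords r d (a # w) = twist_mult r (letter_coords d a) (word_coords r d w)"

lemma word_coords_append:
  "word_coords r d (u @ v) = twist_mult r (word_coords r d u) (word_coords r d v)"
proof (induction u)
  case Nil
  then show ?case by (cases "word_coords r d v") simp
qed (simp add: twist_mult_assoc)

lemma word_coords_pow:
  "word_coords r d (gen_pow Gen_x m) = (0, int m)"
  "word_coords r d (replicate m (Gen_x, False)) = (0, - int m)"
  "word_coords r d (gen_pow Gen_y m) = (m, 0)"
  by (induction m) auto

definition coords_cong :: "nat \<Rightarrow> int \<Rightarrow> nat \<times> int \<Rightarrow> nat \<times> int \<Rightarrow> bool" where
  "coords_cong d N p q \<longleftrightarrow> [fst p = fst q] (mod d) \<and> [snd p = snd q] (mod N)"

lemma coords_cong_twist_mult: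
  assumes "[r ^ d = 1] (mod N)" "coords_cong d N p p'" "coords_cong d N q q'"
  shows "coords_cong d N (twist_mult r p q) (twist_mult r p' q')"
  using assms pow_exponent_cong[OF assms(1)]
  by (cases p; cases p'; cases q; cases q') (simp add: coords_cong_def cong_add cong_mult)

text \<open>
  Evaluation of words is a homomorphism to the semidirect product of the cyclic groups of orders
  \<open>2\<^bsup>\<alpha>-\<epsilon>\<^esup>\<close> and \<open>2\<^sup>\<beta>\<close>, in which both sides of the relation for \<open>y\<close> to the power \<open>2\<^sup>\<beta>\<close> become trivial. This
  shows that the relations do not identify too much, without determining the order of the group.
\<close>

lemma pres_eq_coords_cong:
  assumes r: "r = 2 ^ (\<alpha> - \<delta>) - 1" and order: "[r ^ 2 ^ \<beta> = 1] (mod 2 ^ (\<alpha> - \<epsilon>))"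
    and "pres_eq (metacyclic_neg_relations \<alpha> \<beta> \<epsilon> \<delta>) u v"
  shows "coords_cong (2 ^ \<beta>) (2 ^ (\<alpha> - \<epsilon>)) (word_coords r (2 ^ \<beta>) u) (word_coords r (2 ^ \<beta>) v)"
  using assms(3)
proof (induction rule: pres_eq.induct)
  case (append u u' v v')
  then show ?case unfolding word_coords_append using coords_cong_twist_mult order by blast
next
  case (cancel s b)
  show ?case by (cases s; cases b) (simp_all add: coords_cong_def cong_0_iff)
next
  case (rel u v)
  then consider "u = gen_pow Gen_x (2 ^ \<alpha>)" "v = []"
    | "u = gen_pow Gen_y (2 ^ \<beta>)" "v = gen_pow Gen_x (2 ^ (\<alpha> - \<epsilon>))"
    | "u = [(Gen_y, False), (Gen_x, True), (Gen_y, True)]" "v = gen_pow Gen_x (2 ^ (\<alpha> - \<delta>) - 1)"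
    by (auto simp: metacyclic_neg_relations_def)
  then show ?case
  proof cases
    case 1
    then show ?thesis by (simp add: word_coords_pow coords_cong_def cong_0_iff le_imp_power_dvd)
  next
    case 2
    then show ?thesis by (simp add: word_coords_pow coords_cong_def cong_0_iff cong_sym)
  next
    case 3
    then show ?thesis by (simp add: word_coords_pow coords_cong_def cong_0_iff r of_nat_diff)
  qed
qed (auto simp: coords_cong_def intro: cong_sym cong_trans)

context group
begin

lemma twist_int_pow:
  assumes x: "x \<in> carrier G" and y: "y \<in> carrier G" and xy: "x \<otimes> y = y \<otimes> x [^] (r::int)"
  shows "x [^] (i::int) \<otimes> y = y \<otimes> x [^] (i * r)"
proof -
  have nat: "x [^] int n \<otimes> y = y \<otimes> x [^] (int n * r)" for n
  proof (induction n)
    case (Suc n)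
    have "x [^] int (Suc n) = x [^] int n \<otimes> x" by (simp only: int_pow_int nat_pow_Suc)
    then have "x [^] int (Suc n) \<otimes> y = x [^] int n \<otimes> (x \<otimes> y)"
      using x y by (simp add: m_assoc)
    also have "\<dots> = x [^] int n \<otimes> y \<otimes> x [^] r" unfolding xy using x y by (simp add: m_assoc)
    also have "\<dots> = y \<otimes> x [^] (int n * r + r)" unfolding Suc using x y by (simp add: m_assoc int_pow_mult)
    finally show ?case by (simp add: algebra_simps)
  qed (use x y in simp)
  show ?thesis
  proof (cases i)
    case (nonneg n)
    then show ?thesis using nat by simp
  next
    case (neg n)
    define m where "m = int (Suc n)"
    have i: "i = - m" using neg by (simp add: m_def)
    have cancel: "x [^] k \<otimes> x [^] (- k) = \<one>" "x [^] (- k) \<otimes> x [^] k = \<one>" for k :: int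
      using int_pow_mult[OF x, of k "- k"] int_pow_mult[OF x, of "- k" k] by simp_all
    \<comment> \<open>Insert \<open>x\<close> to the power \<open>m r - m r\<close>, so that the case of a natural exponent applies.\<close>
    have "x [^] (- m) \<otimes> y = x [^] (- m) \<otimes> (y \<otimes> x [^] (m * r)) \<otimes> x [^] (- (m * r))"
      using x y by (simp add: m_assoc cancel)
    also have "y \<otimes> x [^] (m * r) = x [^] m \<otimes> y" unfolding m_def nat ..
    also have "x [^] (- m) \<otimes> (x [^] m \<otimes> y) \<otimes> x [^] (- (m * r)) = y \<otimes> x [^] (- (m * r))"
      using x y by (simp add: cancel flip: m_assoc)
    finally show ?thesis by (simp add: i)
  qed
qed

lemma twist_pow:
  assumes x: "x \<in> carrier G" and y: "y \<in> carrier G" and xy: "x \<otimes> y = y \<otimes> x [^] (r::int)"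
  shows "x [^] (i::int) \<otimes> y [^] (l::nat) = y [^] l \<otimes> x [^] (i * r ^ l)"
proof (induction l)
  case (Suc l)
  have "x [^] i \<otimes> y [^] Suc l = x [^] i \<otimes> y [^] l \<otimes> y" using x y by (simp add: m_assoc)
  also have "\<dots> = y [^] l \<otimes> (x [^] (i * r ^ l) \<otimes> y)" unfolding Suc using x y by (simp add: m_assoc)
  also have "\<dots> = y [^] Suc l \<otimes> x [^] (i * r ^ l * r)"
    unfolding twist_int_pow[OF assms] using x y by (simp add: m_assoc)
  finally show ?case by (simp add: algebra_simps)
qed (use x y in simp)

lemma int_pow_cong:
  assumes "x \<in> carrier G" "x [^] (N::int) = \<one>" "[i = i'] (mod N)"
  shows "x [^] i = x [^] i'"
proof -
  obtain k where "i - i' = N * k" using assms(3) by (auto simp: cong_iff_dvd_diff dvd_def)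
  then have "i = N * k + i'" by simp
  then show ?thesis using assms(1,2) by (simp add: int_pow_mult flip: int_pow_pow)
qed

end

definition word_normal_form :: "nat \<Rightarrow> int \<Rightarrow> metacyclic_gen word" where
  "word_normal_form j i =
     gen_pow Gen_y j @ (if 0 \<le> i then gen_pow Gen_x (nat i) else replicate (nat (- i)) (Gen_x, False))"

lemma word_coords_normal_form: "word_coords r d (word_normal_form j i) = (j, i)"
  by (simp add: word_normal_form_def word_coords_append word_coords_pow)

lemma pres_class_pow:
  "pres_class R (replicate m a) = pres_class R [a] [^]\<^bsub>presented_group R\<^esub> m"
proof (induction m)
  case 0
  then show ?case by (simp add: presented_group_def)
next
  case (Suc m)
  have "replicate (Suc m) a = replicate m a @ [a]" by (simp add: replicate_append_same)
  then show ?case using Suc by (simp flip: mult_pres_class)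
qed

lemma pres_class_carrier [simp]: "pres_class R w \<in> carrier (presented_group R)"
  by (simp add: presented_group_def)

lemma pres_class_inv:
  "inv\<^bsub>presented_group R\<^esub> (pres_class R [(s, b)]) = pres_class R [(s, \<not> b)]"
proof -
  interpret group "presented_group R" by (rule group_presented_group)
  have "pres_class R [(s, \<not> b)] \<otimes>\<^bsub>presented_group R\<^esub> pres_class R [(s, b)] = \<one>\<^bsub>presented_group R\<^esub>"
    using pres_eq.cancel[of R s "\<not> b"] unfolding mult_pres_class
    by (simp add: presented_group_def pres_class_eq_iff)
  then show ?thesis by (intro inv_equality) simp_all
qed

lemma pres_class_normal_form:
  "pres_class R (word_normal_form j i) =
    pres_class R [(Gen_y, True)] [^]\<^bsub>presented_group R\<^esub> j \<otimes>\<^bsub>presented_group R\<^esub>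
    pres_class R [(Gen_x, True)] [^]\<^bsub>presented_group R\<^esub> i"
proof -
  interpret group "presented_group R" by (rule group_presented_group)
  have "pres_class R (if 0 \<le> i then gen_pow Gen_x (nat i) else replicate (nat (- i)) (Gen_x, False))
      = pres_class R [(Gen_x, True)] [^]\<^bsub>presented_group R\<^esub> i"
  proof (cases "0 \<le> i")
    case True
    then have "i = int (nat i)" by simp
    then show ?thesis using True pres_class_pow int_pow_int by metis
  next
    case False
    then have i: "i = - int (nat (- i))" by simp
    have "pres_class R [(Gen_x, True)] [^]\<^bsub>presented_group R\<^esub> (- int (nat (- i)))
      = inv\<^bsub>presented_group R\<^esub> (pres_class R [(Gen_x, True)]) [^]\<^bsub>presented_group R\<^esub> nat (- i)"
      by (simp add: int_pow_neg int_pow_int nat_pow_inv)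
    then show ?thesis using False i by (simp add: pres_class_inv pres_class_pow)
  qed
  then show ?thesis by (simp add: word_normal_form_def pres_class_pow flip: mult_pres_class)
qed

text \<open>
  For both values of \<open>\<epsilon>\<close> the element \<open>y\<close> has period \<open>2\<^bsup>\<beta>+\<epsilon>\<^esup>\<close>, but words determine \<open>j\<close> and \<open>i\<close> only modulo
  \<open>2\<^sup>\<beta>\<close> and \<open>2\<^bsup>\<alpha>-\<epsilon>\<^esup>\<close>. A normal form with these properties exists as every letter has one, the
  inverse of \<open>y\<close> because of the period.
\<close>

lemma metacyclic_neg_coordinates:
  assumes "\<epsilon> \<in> {0, 1}" "\<alpha> \<ge> \<delta> + 2" "\<delta> \<ge> 2" "\<delta> \<le> \<beta>"
  shows "twisted_coordinates (metacyclic_neg \<alpha> \<beta> \<epsilon> \<delta>)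
    (\<lambda>j i. pres_class (metacyclic_neg_relations \<alpha> \<beta> \<epsilon> \<delta>) (word_normal_form j i))
    (2 ^ (\<alpha> - \<delta>) - 1) \<alpha> (\<beta> + \<epsilon>) (\<alpha> - \<delta>) \<beta> (\<alpha> - \<epsilon>)"
proof -
  define R where "R = metacyclic_neg_relations \<alpha> \<beta> \<epsilon> \<delta>"
  define r :: int where r_eq: "r = 2 ^ (\<alpha> - \<delta>) - 1"
  let ?P = "presented_group R"
  interpret P: group ?P by (rule group_presented_group)
  define x where "x = pres_class R [(Gen_x, True)]"
  define y where "y = pres_class R [(Gen_y, True)]"
  define E where "E = (\<lambda>j i. pres_class R (word_normal_form j i))"
  have E: "E j i = y [^]\<^bsub>?P\<^esub> j \<otimes>\<^bsub>?P\<^esub> x [^]\<^bsub>?P\<^esub> i" for j i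
    unfolding E_def x_def y_def by (rule pres_class_normal_form)
  have xy [simp]: "x \<in> carrier ?P" "y \<in> carrier ?P" by (simp_all add: x_def y_def)
  have gen_x: "pres_class R (gen_pow Gen_x m) = x [^]\<^bsub>?P\<^esub> m"
    and gen_y: "pres_class R (gen_pow Gen_y m) = y [^]\<^bsub>?P\<^esub> m" for m :: nat
    by (simp_all add: x_def y_def pres_class_pow)
  have rel: "pres_class R u = pres_class R v" if "(u, v) \<in> R" for u v
    using that by (simp add: pres_class_eq_iff pres_eq.rel)
  have x_order: "x [^]\<^bsub>?P\<^esub> ((2::nat) ^ \<alpha>) = \<one>\<^bsub>?P\<^esub>"
    using rel[of "gen_pow Gen_x (2 ^ \<alpha>)" "[]"] gen_x gen_x[of 0]
    by (simp add: R_def metacyclic_neg_relations_def)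
  have y_pow: "y [^]\<^bsub>?P\<^esub> ((2::nat) ^ \<beta>) = x [^]\<^bsub>?P\<^esub> ((2::nat) ^ (\<alpha> - \<epsilon>))"
    using rel[of "gen_pow Gen_y (2 ^ \<beta>)" "gen_pow Gen_x (2 ^ (\<alpha> - \<epsilon>))"] gen_x gen_y
    by (simp add: R_def metacyclic_neg_relations_def)
  have "(2::nat) ^ (\<beta> + \<epsilon>) = 2 ^ \<beta> * 2 ^ \<epsilon>" by (simp add: power_add)
  then have "y [^]\<^bsub>?P\<^esub> ((2::nat) ^ (\<beta> + \<epsilon>)) = (x [^]\<^bsub>?P\<^esub> ((2::nat) ^ (\<alpha> - \<epsilon>))) [^]\<^bsub>?P\<^esub> ((2::nat) ^ \<epsilon>)"
    by (simp add: P.nat_pow_pow flip: y_pow)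
  also have "\<dots> = x [^]\<^bsub>?P\<^esub> ((2::nat) ^ (\<alpha> - \<epsilon> + \<epsilon>))"
    by (simp add: P.nat_pow_pow power_add)
  also have "\<alpha> - \<epsilon> + \<epsilon> = \<alpha>" using assms(1,2) by auto
  finally have y_order: "y [^]\<^bsub>?P\<^esub> ((2::nat) ^ (\<beta> + \<epsilon>)) = \<one>\<^bsub>?P\<^esub>" by (simp add: x_order)
  have "([(Gen_y, False), (Gen_x, True), (Gen_y, True)], gen_pow Gen_x (2 ^ (\<alpha> - \<delta>) - 1)) \<in> R"
    by (simp add: R_def metacyclic_neg_relations_def)
  from rel[OF this] have "pres_class R ([(Gen_y, False)] @ [(Gen_x, True)] @ [(Gen_y, True)])
      = x [^]\<^bsub>?P\<^esub> ((2::nat) ^ (\<alpha> - \<delta>) - 1)" by (simp add: gen_x)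
  moreover have "x [^]\<^bsub>?P\<^esub> ((2::nat) ^ (\<alpha> - \<delta>) - 1) = x [^]\<^bsub>?P\<^esub> r"
    unfolding r_eq int_pow_int[symmetric] by (simp add: of_nat_diff)
  ultimately have "inv\<^bsub>?P\<^esub> y \<otimes>\<^bsub>?P\<^esub> (x \<otimes>\<^bsub>?P\<^esub> y) = x [^]\<^bsub>?P\<^esub> r"
    by (simp only: x_def y_def pres_class_inv mult_pres_class simp_thms)
  then have twist: "x \<otimes>\<^bsub>?P\<^esub> y = y \<otimes>\<^bsub>?P\<^esub> x [^]\<^bsub>?P\<^esub> r"
    using P.inv_solve_left[of "x [^]\<^bsub>?P\<^esub> r" y "x \<otimes>\<^bsub>?P\<^esub> y"] by simp
  have E_closed: "E j i \<in> carrier ?P" for j i by (simp add: E_def)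
  have E_mult: "E j i \<otimes>\<^bsub>?P\<^esub> E l k = E (j + l) (i * r ^ l + k)" for j i l k
  proof -
    have "E j i \<otimes>\<^bsub>?P\<^esub> E l k
        = y [^]\<^bsub>?P\<^esub> j \<otimes>\<^bsub>?P\<^esub> (x [^]\<^bsub>?P\<^esub> i \<otimes>\<^bsub>?P\<^esub> y [^]\<^bsub>?P\<^esub> l) \<otimes>\<^bsub>?P\<^esub> x [^]\<^bsub>?P\<^esub> k"
      by (simp add: E P.m_assoc)
    also have "\<dots> = (y [^]\<^bsub>?P\<^esub> j \<otimes>\<^bsub>?P\<^esub> y [^]\<^bsub>?P\<^esub> l) \<otimes>\<^bsub>?P\<^esub> (x [^]\<^bsub>?P\<^esub> (i * r ^ l) \<otimes>\<^bsub>?P\<^esub> x [^]\<^bsub>?P\<^esub> k)"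
      unfolding P.twist_pow[OF xy twist] by (simp add: P.m_assoc)
    finally show ?thesis by (simp add: E P.nat_pow_mult P.int_pow_mult)
  qed
  have E_cong: "E j i = E j' i'" if "[j = j'] (mod 2 ^ (\<beta> + \<epsilon>))" "[i = i'] (mod 2 ^ \<alpha>)" for j i j' i'
  proof -
    have "x [^]\<^bsub>?P\<^esub> ((2::int) ^ \<alpha>) = \<one>\<^bsub>?P\<^esub>" using x_order int_pow_int[of ?P x "2 ^ \<alpha>"] by simp
    then have "x [^]\<^bsub>?P\<^esub> i = x [^]\<^bsub>?P\<^esub> i'" using P.int_pow_cong that(2) by simp
    moreover have "y [^]\<^bsub>?P\<^esub> ((2::int) ^ (\<beta> + \<epsilon>)) = \<one>\<^bsub>?P\<^esub>"
      using y_order int_pow_int[of ?P y "2 ^ (\<beta> + \<epsilon>)"] by simp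
    then have "y [^]\<^bsub>?P\<^esub> (int j) = y [^]\<^bsub>?P\<^esub> (int j')"
      using P.int_pow_cong[of y "2 ^ (\<beta> + \<epsilon>)" "int j" "int j'"] that(1) by (simp flip: cong_int_iff)
    ultimately show ?thesis by (simp add: E int_pow_int)
  qed
  have letters: "pres_class R [(Gen_x, True)] = E 0 1" "pres_class R [(Gen_x, False)] = E 0 (- 1)"
      "pres_class R [(Gen_y, True)] = E 1 0"
    by (simp_all add: E_def word_normal_form_def)
  have "\<one>\<^bsub>?P\<^esub> = E 0 0" by (simp add: E)
  have "E (2 ^ (\<beta> + \<epsilon>) - 1) 0 \<otimes>\<^bsub>?P\<^esub> E 1 0 = E (2 ^ (\<beta> + \<epsilon>)) 0" by (simp add: E_mult)
  also have "\<dots> = \<one>\<^bsub>?P\<^esub>" unfolding \<open>\<one>\<^bsub>?P\<^esub> = E 0 0\<close> by (intro E_cong) (simp_all add: cong_0_iff)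
  finally have "inv\<^bsub>?P\<^esub> (E 1 0) = E (2 ^ (\<beta> + \<epsilon>) - 1) 0" by (intro P.inv_equality E_closed)
  then have y_inv: "pres_class R [(Gen_y, False)] = E (2 ^ (\<beta> + \<epsilon>) - 1) 0"
    using pres_class_inv[of R Gen_y True] by (simp add: letters)
  have word: "\<exists>j i. pres_class R w = E j i" for w
  proof (induction w)
    case Nil
    have "pres_class R [] = E 0 0" by (simp add: E_def word_normal_form_def)
    then show ?case by blast
  next
    case (Cons a w)
    then obtain j i where w: "pres_class R w = E j i" by blast
    obtain s b where a: "a = (s, b)" by (cases a)
    have "pres_class R [a] \<in> {E 0 1, E 0 (- 1), E 1 0, E (2 ^ (\<beta> + \<epsilon>) - 1) 0}"
      unfolding a by (cases s; cases b) (simp_all add: letters y_inv)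
    then obtain l k where "pres_class R [a] = E l k" by auto
    then have "pres_class R (a # w) = E l k \<otimes>\<^bsub>?P\<^esub> E j i"
      using mult_pres_class[of R "[a]" w] w by simp
    then show ?case unfolding E_mult by blast
  qed
  have "[r ^ 2 ^ \<beta> = 1] (mod 2 ^ (\<alpha> - \<delta> + \<beta>))"
    unfolding r_eq using assms by (intro twist_order) simp_all
  then have order: "[r ^ 2 ^ \<beta> = 1] (mod 2 ^ (\<alpha> - \<epsilon>))"
    by (rule cong_pow2_le) (use assms(4) in simp)
  have E_eqD: "[j = j'] (mod 2 ^ \<beta>) \<and> [i = i'] (mod 2 ^ (\<alpha> - \<epsilon>))" if "E j i = E j' i'" for j i j' i'
  proof -
    have "pres_eq R (word_normal_form j i) (word_normal_form j' i')"
      using that by (simp add: E_def pres_class_eq_iff)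
    from pres_eq_coords_cong[OF r_eq order this[unfolded R_def]] show ?thesis
      by (simp add: word_coords_normal_form coords_cong_def)
  qed
  have "twisted_coordinates ?P E r \<alpha> (\<beta> + \<epsilon>) (\<alpha> - \<delta>) \<beta> (\<alpha> - \<epsilon>)"
  proof
    show "\<exists>j i. g = E j i" if g: "g \<in> carrier ?P" for g
    proof -
      obtain w where "g = pres_class R w" using g by (auto simp: presented_group_def)
      then show ?thesis using word by simp
    qed
    show "2 \<le> \<alpha> - \<delta>" "2 \<le> \<beta>" "\<alpha> - \<delta> < \<alpha> - \<epsilon>" using assms by auto
  qed (fact E_closed E_mult E_cong E_eqD r_eq)+
  then show ?thesis by (simp add: metacyclic_neg_def R_def r_eq E_def)
qed

lemma twisted_coordinates_iso:
  assumes "twisted_coordinates P E r a b c \<beta> n" "group G" "h \<in> iso P G"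
  shows "twisted_coordinates G (\<lambda>j i. h (E j i)) r a b c \<beta> n"
proof -
  interpret P: twisted_coordinates P E r a b c \<beta> n by (rule assms(1))
  interpret G: group G by (rule assms(2))
  have h: "h \<in> hom P G" "bij_betw h (carrier P) (carrier G)" using assms(3) by (simp_all add: iso_def)
  show ?thesis
  proof
    show "h (E j i) \<in> carrier G" for j i using hom_in_carrier[OF h(1)] by simp
    show "\<exists>j i. g = h (E j i)" if "g \<in> carrier G" for g
    proof -
      have "g \<in> h ` carrier P" using h(2) that by (simp add: bij_betw_def)
      then show ?thesis using P.E_surj by blast
    qed
    show "h (E j i) \<otimes>\<^bsub>G\<^esub> h (E l k) = h (E (j + l) (i * r ^ l + k))" for j i l k
      by (simp add: P.E_mult flip: hom_mult[OF h(1)])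
    show "h (E j i) = h (E j' i')" if "[j = j'] (mod 2 ^ b)" "[i = i'] (mod 2 ^ a)" for j i j' i'
      using P.E_cong[OF that] by simp
    show "[j = j'] (mod 2 ^ \<beta>) \<and> [i = i'] (mod 2 ^ n)" if "h (E j i) = h (E j' i')" for j i j' i'
    proof (rule P.E_eqD)
      show "E j i = E j' i'"
        using h(2) inj_onD[OF _ that P.E_closed P.E_closed] by (simp add: bij_betw_def)
    qed
  qed (use P.r_eq P.c P.\<beta> P.c_less_n in auto)
qed

section \<open>The number of classes\<close>

theorem proposition4p10:
  fixes G :: "('a, 'b) monoid_scheme" and \<alpha> \<beta> \<epsilon> \<delta> :: nat
  assumes "\<alpha> > 0" and "\<beta> > 0" and "\<epsilon> \<in> {0, 1}"
    and "\<delta> \<le> \<beta>" and "\<alpha> \<ge> \<delta> + 2" and "\<delta> + \<epsilon> \<le> \<alpha>"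
    and "\<epsilon> = 1 \<Longrightarrow> \<beta> \<ge> \<delta> + 1"
    and "\<delta> \<ge> 2"
    and "group G" and "G \<cong> metacyclic_neg \<alpha> \<beta> \<epsilon> \<delta>"
  shows "eta G \<ge> \<alpha> + \<beta> - 2 \<and>
    (eta G = \<alpha> + \<beta> - 2 \<longleftrightarrow>
      \<beta> = \<delta> \<and> (\<beta> = 3 \<or> (\<beta> \<ge> 4 \<and> \<alpha> = \<beta> + 2)))"
proof -
  have "metacyclic_neg \<alpha> \<beta> \<epsilon> \<delta> \<cong> G"
    using group.iso_sym[OF assms(9,10)] .
  then obtain h where h: "h \<in> iso (metacyclic_neg \<alpha> \<beta> \<epsilon> \<delta>) G" by (auto simp: is_iso_def)
  define E where "E = (\<lambda>j i.
    h (pres_class (metacyclic_neg_relations \<alpha> \<beta> \<epsilon> \<delta>) (word_normal_form j i)))"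
  define c where "c = \<alpha> - \<delta>"
  define r :: int where r_eq: "r = 2 ^ c - 1"
  have coordinates: "twisted_coordinates G E r \<alpha> (\<beta> + \<epsilon>) c \<beta> (\<alpha> - \<epsilon>)"
    using twisted_coordinates_iso[OF metacyclic_neg_coordinates assms(9) h] assms
    unfolding E_def c_def r_eq by blast
  have c: "2 \<le> c" and \<beta>: "2 \<le> \<beta>" using assms(4,5,8) by (simp_all add: c_def)
  have \<alpha>: "\<alpha> = c + \<delta>" using assms(5) by (simp add: c_def)
  have lower: "2 + (\<beta> + (\<beta> - 3)) + (c - 1 + of_bool (3 \<le> c \<and> 4 \<le> \<beta>)) \<le> eta G"
    using twisted_coordinates.card_reps_le_eta[OF coordinates]
    unfolding twisted_coordinates.card_reps[OF coordinates] .
  have upper: "eta G = 2 + (\<beta> + (\<beta> - 3)) + (c - 1 + of_bool (3 \<le> c \<and> 4 \<le> \<beta>))"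
    if "\<beta> = \<delta>" "\<beta> = 3 \<or> \<alpha> = \<beta> + 2"
  proof -
    have "\<epsilon> = 0" using assms(3,7) that(1) by auto
    then have "faithful_twisted_coordinates G E r \<alpha> \<beta> c"
      using coordinates by (simp add: faithful_twisted_coordinates_def)
    moreover have "\<beta> = 3 \<or> c = 2" using that \<alpha> by auto
    ultimately have "eta G = card (twisted_coordinates.reps c \<beta>)"
      by (rule faithful_twisted_coordinates.eta_eq_card_reps)
    then show ?thesis unfolding twisted_coordinates.card_reps[OF coordinates] .
  qed
  show ?thesis
  proof (intro conjI iffI)
    show "\<alpha> + \<beta> - 2 \<le> eta G" using lower \<alpha> assms(4,8) c by linarith
  next
    assume eq: "eta G = \<alpha> + \<beta> - 2"
    show "\<beta> = \<delta>" using lower eq \<alpha> assms(4,8) c by linarith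
    have "\<not> (3 \<le> c \<and> 4 \<le> \<beta>)"
    proof
      assume "3 \<le> c \<and> 4 \<le> \<beta>"
      then show False using lower eq \<alpha> assms(4,8) by simp
    qed
    moreover have "\<beta> \<noteq> 2" using lower eq \<alpha> assms(4,8) c by auto
    ultimately show "\<beta> = 3 \<or> (\<beta> \<ge> 4 \<and> \<alpha> = \<beta> + 2)"
      using \<alpha> \<beta> c \<open>\<beta> = \<delta>\<close> by auto
  next
    assume *: "\<beta> = \<delta> \<and> (\<beta> = 3 \<or> (\<beta> \<ge> 4 \<and> \<alpha> = \<beta> + 2))"
    then have "eta G = 2 + (\<beta> + (\<beta> - 3)) + (c - 1 + of_bool (3 \<le> c \<and> 4 \<le> \<beta>))"
      using upper by blast
    then show "eta G = \<alpha> + \<beta> - 2" using * \<alpha> c by auto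
  qed
qed

end
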